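(* Let $X$ be a shift space on a finite alphabet $A$ with positive topological entropy, and let $\mathcal{L}$ be its language. Suppose that there are a nondecreasing function $g\colon \mathbb{N}\to\mathbb{N}$ with $\lim_{n\to\infty} g(n)/\log(n) = 0$ and a set $\mathcal{G}\subset\mathcal{L}$ with specification such that $\mathcal{L}$ is $g$-Hamming approachable by $\mathcal{G}$. Then every Hölder continuous potential $\varphi\colon X\to\mathbb{R}$ is hyperbolic, i.e. $P(\varphi) > \sup_{\mu} \int\varphi\,d\mu$, where the supremum is over all $\sigma$-invariant Borel probability measures $\mu$ on $X$.
   Context: $\mathbb{N}=\{1,2,3,\dots\}$. For a finite set $A$, $\sigma\colon A^{\mathbb{N}}\to A^{\mathbb{N}}$ is the left shift, and $A^{\mathbb{N}}$ has the metric $d(x,y)=2^{-\min\{n\in\mathbb{N} : x_n\neq y_n\}}$ for $x\ne y$; Hölder continuity is with respect to $d$. A shift space over $A$ is a closed $\sigma$-invariant subset $X\subset A^{\mathbb{N}}$. Its language $\mathcal{L}$ is the set of all finite words (including the empty word) appearing in elements of $X$; $|w|$ is the length of $w$, and for $\mathcal{D}\subset\mathcal{L}$, $\mathcal{D}_n$ is the set of words of length $n$ in $\mathcal{D}$. Pressure: $P(\varphi)=\sup_\mu\big(h_\mu(\sigma)+\int\varphi\,d\mu\big)$, the supremum being over all $\sigma$-invariant Borel probability measures on $X$. Specification: a prefix of a word $w$ is any word $w_1\cdots w_k$ with $k\le|w|$; a suffix is any word $w_k\cdots w_{|w|}$. A set $\mathcal{G}\subset\mathcal{L}$ has specification if there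 is $\tau\in\mathbb{N}$ such that for every $v,w\in\mathcal{G}$ there is $u\in\mathcal{L}$ with $|u|\le\tau$ such that $v'uw'\in\mathcal{G}$ whenever $v'$ is a suffix of $v$ and $w'$ is a prefix of $w$ with $v',w'\in\mathcal{G}$ (this includes the case $v'=v$, $w'=w$). Hamming approachability: for words $v,w$ of the same length, $d_{\mathrm{Ham}}(v,w)=\#\{i : v_i\ne w_i\}$. $\mathcal{L}$ is $g$-Hamming approachable by $\mathcal{G}$ if there is $n_0\in\mathbb{N}$ such that for every $n\ge n_0$ and $w\in\mathcal{L}_n$ there is $v\in\mathcal{G}_n$ with $d_{\mathrm{Ham}}(v,w)\le g(n)$. *)

theory Defs
  imports "HOL-Probability.Probability" "HOL-Library.Sublist"
begin

text \<open>
  A sequence \<open>x\<^sub>1 x\<^sub>2 \<dots>\<close> over the alphabet is a function \<open>x\<close> on \<open>nat\<close> with \<open>x i\<close> standing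
  for \<open>x\<^sub>i\<^sub>+\<^sub>1\<close>; words are lists.
\<close>

definition full_shift :: "'a set \<Rightarrow> (nat \<Rightarrow> 'a) set" where
  "full_shift A = {x. \<forall>i. x i \<in> A}"

definition shift :: "(nat \<Rightarrow> 'a) \<Rightarrow> nat \<Rightarrow> 'a" where
  "shift x = (\<lambda>i. x (Suc i))"

text \<open>The \<open>Suc\<close> accounts for the indexing from 0.\<close>

definition seq_dist :: "(nat \<Rightarrow> 'a) \<Rightarrow> (nat \<Rightarrow> 'a) \<Rightarrow> real" where
  "seq_dist x y = (if x = y then 0 else 2 powr - real (Suc (LEAST i. x i \<noteq> y i)))"

lemma seq_dist_ultra: "seq_dist x z \<le> max (seq_dist x y) (seq_dist y z)"
proof (cases "x = y \<or> y = z \<or> x = z")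
  case True
  then show ?thesis by (auto simp: seq_dist_def le_max_iff_disj)
next
  case False
  define k where "k = (LEAST i. x i \<noteq> z i)"
  from False have "\<exists>i. x i \<noteq> z i" by auto
  then have "x k \<noteq> z k" unfolding k_def by (rule LeastI_ex)
  then have "x k \<noteq> y k \<or> y k \<noteq> z k" by auto
  then have "(LEAST i. x i \<noteq> y i) \<le> k \<or> (LEAST i. y i \<noteq> z i) \<le> k"
    by (auto intro: Least_le)
  then show ?thesis using False
    by (auto simp: seq_dist_def k_def[symmetric] le_max_iff_disj)
qed

lemma Metric_space_seq_dist: "Metric_space M seq_dist"
proof
  fix x y z :: "nat \<Rightarrow> 'a"
  show nonneg: "0 \<le> seq_dist x y" for x y :: "nat \<Rightarrow> 'a" by (simp add: seq_dist_def)
  show "seq_dist x y = seq_dist y x" by (simp add: seq_dist_def eq_commute)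
  show "(seq_dist x y = 0) = (x = y)" by (simp add: seq_dist_def)
  show "seq_dist x z \<le> seq_dist x y + seq_dist y z"
    using seq_dist_ultra[of x z y] nonneg[of x y] nonneg[of y z] by linarith
qed

definition seq_topology :: "'a set \<Rightarrow> (nat \<Rightarrow> 'a) topology" where
  "seq_topology A = Metric_space.mtopology (full_shift A) seq_dist"

definition shift_space :: "'a set \<Rightarrow> (nat \<Rightarrow> 'a) set \<Rightarrow> bool" where
  "shift_space A X \<longleftrightarrow> closedin (seq_topology A) X \<and> shift ` X \<subseteq> X"

definition language :: "(nat \<Rightarrow> 'a) set \<Rightarrow> 'a list set" where
  "language X = {map x [i..<i + n] | x i n. x \<in> X}"

definition words_of_length :: "'a list set \<Rightarrow> nat \<Rightarrow> 'a list set" where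
  "words_of_length D n = {w \<in> D. length w = n}"

text \<open>By subadditivity, the upper limit is a limit.\<close>

definition topological_entropy :: "(nat \<Rightarrow> 'a) set \<Rightarrow> ereal" where
  "topological_entropy X =
     limsup (\<lambda>n. ereal (ln (real (card (words_of_length (language X) n))) / real n))"

definition has_specification :: "'a list set \<Rightarrow> 'a list set \<Rightarrow> bool" where
  "has_specification L G \<longleftrightarrow>
     (\<exists>\<tau>\<ge>1. \<forall>v\<in>G. \<forall>w\<in>G. \<exists>u\<in>L. length u \<le> \<tau> \<and>
        (\<forall>v' w'. suffix v' v \<and> prefix w' w \<and> v' \<in> G \<and> w' \<in> G \<longrightarrow> v' @ u @ w' \<in> G))"

text \<open>Only meaningful for words of equal length.\<close>

definition hamming_dist :: "'a list \<Rightarrow> 'a list \<Rightarrow> nat" where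
  "hamming_dist v w = card {i. i < length v \<and> v ! i \<noteq> w ! i}"

definition hamming_approachable :: "(nat \<Rightarrow> nat) \<Rightarrow> 'a list set \<Rightarrow> 'a list set \<Rightarrow> bool" where
  "hamming_approachable g L G \<longleftrightarrow>
     (\<exists>n\<^sub>0\<ge>1. \<forall>n\<ge>n\<^sub>0. \<forall>w\<in>words_of_length L n. \<exists>v\<in>words_of_length G n. hamming_dist v w \<le> g n)"

definition hoelder_on :: "(nat \<Rightarrow> 'a) set \<Rightarrow> ((nat \<Rightarrow> 'a) \<Rightarrow> real) \<Rightarrow> bool" where
  "hoelder_on X \<phi> \<longleftrightarrow>
     (\<exists>C \<alpha>. \<alpha> > 0 \<and> (\<forall>x\<in>X. \<forall>y\<in>X. \<bar>\<phi> x - \<phi> y\<bar> \<le> C * seq_dist x y powr \<alpha>))"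

definition borel_on :: "'a set \<Rightarrow> (nat \<Rightarrow> 'a) set \<Rightarrow> (nat \<Rightarrow> 'a) measure" where
  "borel_on A X = sigma X {U. openin (subtopology (seq_topology A) X) U}"

definition invariant_measures :: "'a set \<Rightarrow> (nat \<Rightarrow> 'a) set \<Rightarrow> (nat \<Rightarrow> 'a) measure set" where
  "invariant_measures A X =
     {\<mu>. sets \<mu> = sets (borel_on A X) \<and> prob_space \<mu> \<and>
         shift \<in> measurable \<mu> \<mu> \<and> distr \<mu> \<mu> shift = \<mu>}"

text \<open>
  Kolmogorov--Sinai entropy of a measure-preserving map \<open>T\<close>. Null blocks contribute 0 to
  \<open>partition_entropy\<close> since \<open>0 * ln 0 = 0\<close>, so the empty set may occur in \<open>dynamical_join\<close>.
  The upper limit in \<open>entropy_wrt\<close> is again a limit by subadditivity.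
\<close>

definition finite_measurable_partition :: "'b measure \<Rightarrow> 'b set set \<Rightarrow> bool" where
  "finite_measurable_partition \<mu> P \<longleftrightarrow> finite P \<and> P \<subseteq> sets \<mu> \<and> partition_on (space \<mu>) P"

definition partition_entropy :: "'b measure \<Rightarrow> 'b set set \<Rightarrow> real" where
  "partition_entropy \<mu> P = (\<Sum>B\<in>P. - measure \<mu> B * ln (measure \<mu> B))"

definition dynamical_join :: "'b measure \<Rightarrow> ('b \<Rightarrow> 'b) \<Rightarrow> 'b set set \<Rightarrow> nat \<Rightarrow> 'b set set" where
  "dynamical_join \<mu> T P n =
     {{x \<in> space \<mu>. \<forall>i<n. (T ^^ i) x \<in> C i} | C. \<forall>i<n. C i \<in> P}"

definition entropy_wrt :: "'b measure \<Rightarrow> ('b \<Rightarrow> 'b) \<Rightarrow> 'b set set \<Rightarrow> ereal" where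
  "entropy_wrt \<mu> T P =
     limsup (\<lambda>n. ereal (partition_entropy \<mu> (dynamical_join \<mu> T P n) / real n))"

definition measure_entropy :: "'b measure \<Rightarrow> ('b \<Rightarrow> 'b) \<Rightarrow> ereal" where
  "measure_entropy \<mu> T = (SUP P \<in> {P. finite_measurable_partition \<mu> P}. entropy_wrt \<mu> T P)"

definition pressure :: "'a set \<Rightarrow> (nat \<Rightarrow> 'a) set \<Rightarrow> ((nat \<Rightarrow> 'a) \<Rightarrow> real) \<Rightarrow> ereal" where
  "pressure A X \<phi> =
     (SUP \<mu> \<in> invariant_measures A X. measure_entropy \<mu> shift + ereal (integral\<^sup>L \<mu> \<phi>))"

definition hyperbolic :: "'a set \<Rightarrow> (nat \<Rightarrow> 'a) set \<Rightarrow> ((nat \<Rightarrow> 'a) \<Rightarrow> real) \<Rightarrow> bool" where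
  "hyperbolic A X \<phi> \<longleftrightarrow>
     pressure A X \<phi> > (SUP \<mu> \<in> invariant_measures A X. ereal (integral\<^sup>L \<mu> \<phi>))"

end

theory Submission imports Defs "HOL-Real_Asymp.Real_Asymp"
begin

text \<open>Let \<open>x\<close> nearly maximize the Birkhoff sum \<open>S\<^sub>n \<phi>\<close>. Cutting \<open>x\<^sub>1 \<dots> x\<^sub>n\<close> at any
  of about \<open>n\<close> positions, replacing both parts by words of \<open>G\<close> and inserting a short word between
  them costs only \<open>O(1 + g n)\<close> of the Birkhoff sum. The inserted word is chosen not to occur in \<open>x\<close>
  near the cut (positive entropy provides enough candidates), so at most \<open>O(1 + g n)\<close> cuts produce
  the same word. This leaves at least \<open>n / O(1 + g n)\<close> distinct words, and a synchronizing argument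
  shows that after a bounded extension they can be concatenated freely. The Bernoulli measure on
  free concatenations, averaged over a block, has entropy about \<open>(ln n - O(ln (1 + g n))) / n\<close> and
  integral at least \<open>S\<^sub>n \<phi> x / n - O(1 + g n) / n\<close>; as \<open>g n\<close> is of smaller order than \<open>ln n\<close>, the
  sum exceeds the supremum of the integrals.\<close>

section \<open>Cylinders and the Borel structure\<close>

text \<open>Cutting and regluing alone gains nothing: if \<open>x\<close> is periodic, say, all cuts
  may lead to the same word. An insertion foreign to \<open>x\<close> marks the cut. Two things blur
  the mark. The extensions on either side have unknown lengths up to \<kappa>, so the insertion has
  to differ from the words of \<open>x\<close> throughout a window whose size depends on \<kappa>
  only. And an approximating word may contain the insertion by accident, but only where it errs,
  which limits the accidents by \<open>g n\<close>. Specification provides connecting words that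
  depend on the pair to be joined, so independently chosen blocks would not sit at fixed places.
  This is why a set closed under plain concatenation is needed, and why only words of one common
  length are kept: the blocks of a concatenation are then located up to a phase. Entropy and
  integral are both divided by that length, which differs from \<open>n\<close> by a bounded amount;
  hence the number of cuts, worth \<open>ln n\<close>, competes directly with the total loss in the
  Birkhoff sum.\<close>

definition cylinder :: "(nat \<Rightarrow> 'a) set \<Rightarrow> 'a list \<Rightarrow> (nat \<Rightarrow> 'a) set" where
  "cylinder X w = {x \<in> X. map x [0..<length w] = w}"

lemma cylinder_iff: "x \<in> cylinder X w \<longleftrightarrow> x \<in> X \<and> (\<forall>i<length w. x i = w ! i)"
proof -
  have "map x [0..<length w] = w \<longleftrightarrow> (\<forall>i<length w. x i = w ! i)"
    by (subst list_eq_iff_nth_eq) simp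
  then show ?thesis by (simp add: cylinder_def)
qed

lemma funpow_shift: "(shift ^^ k) x = (\<lambda>i. x (i + k))"
  by (induction k arbitrary: x) (auto simp: shift_def)

lemma seq_dist_le:
  assumes "\<And>i. i < k \<Longrightarrow> x i = y i"
  shows "seq_dist x y \<le> 2 powr - real (Suc k)"
proof (cases "x = y")
  case False
  then have "\<exists>i. x i \<noteq> y i" by auto
  then have "x (LEAST i. x i \<noteq> y i) \<noteq> y (LEAST i. x i \<noteq> y i)" by (rule LeastI_ex)
  then have "k \<le> (LEAST i. x i \<noteq> y i)" using assms linorder_not_less by blast
  then show ?thesis using False by (simp add: seq_dist_def)
qed (simp add: seq_dist_def)

lemma seq_dist_less_imp_eq:
  assumes "seq_dist x y < 2 powr - real k" "i < k"
  shows "x i = y i"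
proof (rule ccontr)
  assume "x i \<noteq> y i"
  then have "x \<noteq> y" "(LEAST i. x i \<noteq> y i) \<le> i" by (auto intro: Least_le)
  then have "2 powr - real k \<le> seq_dist x y" using \<open>i < k\<close> by (auto simp: seq_dist_def)
  then show False using assms by simp
qed

lemma shift_space_subset:
  assumes "shift_space A X"
  shows "X \<subseteq> full_shift A"
proof -
  interpret M: Metric_space "full_shift A" seq_dist by (rule Metric_space_seq_dist)
  show ?thesis using assms closedin_subset[of "seq_topology A" X]
    by (simp add: shift_space_def seq_topology_def)
qed

lemma funpow_shift_mem: "shift_space A X \<Longrightarrow> x \<in> X \<Longrightarrow> (shift ^^ k) x \<in> X"
  by (induction k) (auto simp: shift_space_def)

text \<open>Closedness of \<open>X\<close> enters through this criterion: a sequence built by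
  concatenation is approached by the points of \<open>X\<close> whose prefixes it shares.\<close>

lemma prefix_limit_mem:
  assumes "shift_space A X" and x: "x \<in> full_shift A"
    and pre: "\<And>n. \<exists>y\<in>X. \<forall>i<n. y i = x i"
  shows "x \<in> X"
proof (rule ccontr)
  interpret M: Metric_space "full_shift A" seq_dist by (rule Metric_space_seq_dist)
  assume "x \<notin> X"
  with assms obtain r where r: "r > 0" "disjnt X (M.mball x r)"
    unfolding shift_space_def seq_topology_def M.closedin_metric by blast
  obtain k :: nat where k: "(1/2) ^ k < r" using r real_arch_pow_inv[of r "1/2"] by auto
  obtain y where y: "y \<in> X" "\<forall>i<k. y i = x i" using pre by blast
  have "seq_dist x y \<le> 2 powr - real (Suc k)" using y by (intro seq_dist_le) auto
  also have "\<dots> \<le> 2 powr - real k" by simp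
  also have "\<dots> = (1/2) ^ k" by (simp add: powr_minus powr_realpow power_one_over field_simps)
  finally have "y \<in> M.mball x r" using k x y shift_space_subset[OF assms(1)] by auto
  with y r show False by (auto simp: disjnt_def)
qed

lemma cylinder_nbhd:
  assumes "shift_space A X" "openin (subtopology (seq_topology A) X) U" "x \<in> U"
  shows "\<exists>n. cylinder X (map x [0..<n]) \<subseteq> U"
proof -
  interpret M: Metric_space "full_shift A" seq_dist by (rule Metric_space_seq_dist)
  obtain T where T: "openin M.mtopology T" "U = T \<inter> X"
    using assms by (auto simp: openin_subtopology seq_topology_def)
  then obtain r where r: "r > 0" "M.mball x r \<subseteq> T"
    using assms by (auto simp: M.openin_mtopology)
  obtain k :: nat where k: "(1/2) ^ k < r" using r real_arch_pow_inv[of r "1/2"] by auto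
  have "y \<in> U" if "y \<in> cylinder X (map x [0..<k])" for y
  proof -
    have y: "y \<in> X" "map y [0..<k] = map x [0..<k]" using that by (auto simp: cylinder_def)
    have "x \<in> full_shift A" using assms(3) T shift_space_subset[OF assms(1)] by auto
    have "seq_dist x y \<le> 2 powr - real (Suc k)" using y by (intro seq_dist_le) auto
    also have "\<dots> \<le> 2 powr - real k" by simp
    also have "\<dots> = (1/2) ^ k" by (simp add: powr_minus powr_realpow power_one_over field_simps)
    finally have "y \<in> M.mball x r" using k \<open>x \<in> full_shift A\<close> y shift_space_subset[OF assms(1)] by auto
    with r T y show ?thesis by auto
  qed
  then show ?thesis by blast
qed

lemma openin_cylinder:
  assumes "shift_space A X"
  shows "openin (subtopology (seq_topology A) X) (cylinder X w)"
proof -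
  interpret M: Metric_space "full_shift A" seq_dist by (rule Metric_space_seq_dist)
  define T where "T = {x \<in> full_shift A. map x [0..<length w] = w}"
  have "\<exists>r>0. M.mball x r \<subseteq> T" if x: "x \<in> T" for x
  proof (intro exI conjI subsetI)
    fix y assume y: "y \<in> M.mball x (2 powr - real (length w))"
    then have "map y [0..<length w] = map x [0..<length w]"
      using seq_dist_less_imp_eq[of x y "length w"] by auto
    with x y show "y \<in> T" by (auto simp: T_def)
  qed auto
  then have "openin (seq_topology A) T"
    by (auto simp: seq_topology_def M.openin_mtopology T_def)
  moreover have "cylinder X w = T \<inter> X"
    using shift_space_subset[OF assms] by (auto simp: cylinder_def T_def)
  ultimately show ?thesis by (auto simp: openin_subtopology)
qed

lemma space_borel_on [simp]: "space (borel_on A X) = X"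
  unfolding borel_on_def by (rule space_measure_of) (use openin_subset in fastforce)

lemma openin_borel_on: "openin (subtopology (seq_topology A) X) U \<Longrightarrow> U \<in> sets (borel_on A X)"
  unfolding borel_on_def
  by (rule in_measure_of) (use openin_subset in fastforce)+

lemma cylinder_borel_on: "shift_space A X \<Longrightarrow> cylinder X w \<in> sets (borel_on A X)"
  by (intro openin_borel_on openin_cylinder)

section \<open>Cylinders as a countable base\<close>

lemma Union_cylinders:
  assumes "shift_space A X" "U \<subseteq> X" "\<And>x. x \<in> U \<Longrightarrow> \<exists>n. cylinder X (map x [0..<n]) \<subseteq> U"
  shows "U = (\<Union>w\<in>{w\<in>lists A. cylinder X w \<subseteq> U}. cylinder X w)"
proof (intro equalityI subsetI)
  fix x assume x: "x \<in> U"
  obtain n where n: "cylinder X (map x [0..<n]) \<subseteq> U" using assms(3)[OF x] by blast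
  have "x \<in> X" using x assms(2) by auto
  then have "x \<in> full_shift A" using shift_space_subset[OF assms(1)] by auto
  then have "map x [0..<n] \<in> lists A" by (auto simp: full_shift_def)
  moreover have "x \<in> cylinder X (map x [0..<n])" using \<open>x \<in> X\<close> by (simp add: cylinder_def)
  ultimately show "x \<in> (\<Union>w\<in>{w\<in>lists A. cylinder X w \<subseteq> U}. cylinder X w)" using n by auto
qed auto

lemma countable_cylinders: "finite A \<Longrightarrow> countable {w\<in>lists A. cylinder X w \<subseteq> U}"
  by (rule countable_subset[of _ "lists A"]) (auto intro: countable_finite)

lemma borel_on_cylinderI:
  assumes "finite A" "shift_space A X" "U \<subseteq> X"
    "\<And>x. x \<in> U \<Longrightarrow> \<exists>n. cylinder X (map x [0..<n]) \<subseteq> U"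
  shows "U \<in> sets (borel_on A X)"
  by (subst Union_cylinders[OF assms(2-4)], assumption, rule sets.countable_UN')
    (auto intro: cylinder_borel_on assms countable_cylinders)

text \<open>A finite alphabet has only countably many words, so an open set is a countable union of
  cylinders and measurability can be tested on cylinders. For sequences assembled from random blocks
  the preimage of a cylinder constrains finitely many blocks.\<close>

lemma measurable_borel_onI:
  assumes "finite A" "shift_space A X" "f \<in> space M \<rightarrow> X"
    and "\<And>w. f -` cylinder X w \<inter> space M \<in> sets M"
  shows "f \<in> measurable M (borel_on A X)"
  unfolding borel_on_def
proof (rule measurable_measure_of)
  fix U assume "U \<in> {U. openin (subtopology (seq_topology A) X) U}"
  then have op: "openin (subtopology (seq_topology A) X) U" by simp
  then have "U \<subseteq> X" using openin_subset by fastforce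
  define W where "W = {w\<in>lists A. cylinder X w \<subseteq> U}"
  have U: "U = (\<Union>w\<in>W. cylinder X w)"
    unfolding W_def using \<open>U \<subseteq> X\<close> cylinder_nbhd[OF assms(2) op] by (intro Union_cylinders[OF assms(2)])
  have "(\<Union>w\<in>W. f -` cylinder X w \<inter> space M) \<in> sets M"
    using assms unfolding W_def by (intro sets.countable_UN' countable_cylinders) auto
  also have "(\<Union>w\<in>W. f -` cylinder X w \<inter> space M) = f -` U \<inter> space M" by (auto simp: U)
  finally show "f -` U \<inter> space M \<in> sets M" .
next
  show "{U. openin (subtopology (seq_topology A) X) U} \<subseteq> Pow X"
    using openin_subset by fastforce
  show "f \<in> space M \<rightarrow> X" by fact
qed

lemma measurable_shift:
  assumes "finite A" "shift_space A X"
  shows "shift \<in> measurable (borel_on A X) (borel_on A X)"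
proof (rule measurable_borel_onI[OF assms])
  show "shift \<in> space (borel_on A X) \<rightarrow> X" using assms by (auto simp: shift_space_def)
  fix w
  show "shift -` cylinder X w \<inter> space (borel_on A X) \<in> sets (borel_on A X)"
  proof (rule borel_on_cylinderI[OF assms])
    fix x assume x: "x \<in> shift -` cylinder X w \<inter> space (borel_on A X)"
    show "\<exists>n. cylinder X (map x [0..<n]) \<subseteq> shift -` cylinder X w \<inter> space (borel_on A X)"
    proof (intro exI subsetI)
      fix y assume y: "y \<in> cylinder X (map x [0..<Suc (length w)])"
      then have "\<forall>i<Suc (length w). y i = x i" by (simp add: cylinder_def list_eq_iff_nth_eq del: upt_Suc)
      then have "map (shift y) [0..<length w] = map (shift x) [0..<length w]" by (auto simp: shift_def)
      then have "map (shift y) [0..<length w] = w" using x by (simp add: cylinder_def del: map_eq_conv)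
      moreover have "shift y \<in> X" "y \<in> X" using y assms(2) by (auto simp: cylinder_def shift_space_def)
      ultimately show "y \<in> shift -` cylinder X w \<inter> space (borel_on A X)"
        by (simp add: cylinder_def)
    qed
  qed auto
qed

text \<open>With \<theta> = \<open>2 powr - \<alpha>\<close>, agreement on \<open>k\<close> letters
  gives a bound decaying geometrically in \<open>k\<close>, the form in which errors along an orbit
  can be summed. \<open>\<bar>C\<bar>\<close> replaces \<open>C\<close> because the definition of
  \<open>hoelder_on\<close> leaves the sign of its constant open.\<close>

lemma hoelder_onD:
  assumes "hoelder_on X \<phi>"
  shows "\<exists>C \<theta>. 0 \<le> C \<and> 0 < \<theta> \<and> \<theta> < 1 \<and>
    (\<forall>x\<in>X. \<forall>y\<in>X. \<forall>k. (\<forall>i<k. x i = y i) \<longrightarrow> \<bar>\<phi> x - \<phi> y\<bar> \<le> C * \<theta> ^ k)"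
proof -
  obtain C \<alpha> where a: "\<alpha> > 0" and h: "\<And>x y. x\<in>X \<Longrightarrow> y\<in>X \<Longrightarrow> \<bar>\<phi> x - \<phi> y\<bar> \<le> C * seq_dist x y powr \<alpha>"
    using assms by (auto simp: hoelder_on_def)
  have "\<bar>\<phi> x - \<phi> y\<bar> \<le> \<bar>C\<bar> * (2 powr - \<alpha>) ^ k" if xy: "x \<in> X" "y \<in> X" "\<forall>i<k. x i = y i" for x y k
  proof -
    have "\<bar>\<phi> x - \<phi> y\<bar> \<le> \<bar>C\<bar> * seq_dist x y powr \<alpha>"
      using h[OF xy(1,2)] by (rule order_trans) (intro mult_right_mono, auto)
    also have "seq_dist x y \<le> 2 powr - real k"
      using seq_dist_le[of k x y] xy by (force intro: order_trans)
    then have "seq_dist x y powr \<alpha> \<le> (2 powr - real k) powr \<alpha>"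
      using a by (intro powr_mono2) (auto simp: seq_dist_def)
    also have "\<dots> = (2 powr - \<alpha>) ^ k" by (simp add: powr_powr powr_power mult.commute)
    finally show ?thesis by (simp add: mult_left_mono)
  qed
  moreover have "2 powr - \<alpha> < 1" using a by (simp add: powr_less_one)
  ultimately show ?thesis by (intro exI[of _ "\<bar>C\<bar>"] exI[of _ "2 powr - \<alpha>"]) auto
qed

lemma hoelder_measurable:
  assumes "finite A" "shift_space A X" "hoelder_on X \<phi>"
  shows "\<phi> \<in> borel_measurable (borel_on A X)"
proof (rule borel_measurableI)
  fix S :: "real set" assume S: "open S"
  obtain C \<theta> where C: "0 \<le> C" "0 < \<theta>" "\<theta> < 1"
    "\<And>x y k. x\<in>X \<Longrightarrow> y\<in>X \<Longrightarrow> (\<forall>i<k. x i = y i) \<Longrightarrow> \<bar>\<phi> x - \<phi> y\<bar> \<le> C * \<theta> ^ k"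
    using hoelder_onD[OF assms(3)] by blast
  let ?U = "\<phi> -` S \<inter> X"
  have "?U \<in> sets (borel_on A X)"
  proof (rule borel_on_cylinderI[OF assms(1,2)])
    fix x assume x: "x \<in> ?U"
    then obtain e where e: "e > 0" "\<And>z. dist z (\<phi> x) < e \<Longrightarrow> z \<in> S"
      using S by (auto simp: open_dist)
    have "(\<lambda>k. C * \<theta> ^ k) \<longlonglongrightarrow> C * 0" using C by (intro tendsto_intros LIMSEQ_realpow_zero) auto
    then have "\<forall>\<^sub>F k in sequentially. C * \<theta> ^ k < e" using e by (intro order_tendstoD) auto
    then obtain k where k: "C * \<theta> ^ k < e" by (auto simp: eventually_sequentially)
    have "cylinder X (map x [0..<k]) \<subseteq> ?U"
    proof
      fix y assume y: "y \<in> cylinder X (map x [0..<k])"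
      then have "\<bar>\<phi> y - \<phi> x\<bar> \<le> C * \<theta> ^ k" using x by (intro C(4)) (auto simp: cylinder_def)
      then show "y \<in> ?U" using k e y by (auto simp: cylinder_def dist_real_def)
    qed
    then show "\<exists>n. cylinder X (map x [0..<n]) \<subseteq> ?U" by blast
  qed auto
  then show "\<phi> -` S \<inter> space (borel_on A X) \<in> sets (borel_on A X)" by simp
qed

lemma hoelder_bounded:
  assumes "hoelder_on X \<phi>"
  shows "\<exists>b\<ge>0. \<forall>x\<in>X. \<bar>\<phi> x\<bar> \<le> b"
proof (cases "X = {}")
  case False
  then obtain x\<^sub>0 where x0: "x\<^sub>0 \<in> X" by auto
  obtain C \<theta> where C: "0 \<le> C" "0 < \<theta>" "\<theta> < 1"
    "\<And>x y k. x\<in>X \<Longrightarrow> y\<in>X \<Longrightarrow> (\<forall>i<k. x i = y i) \<Longrightarrow> \<bar>\<phi> x - \<phi> y\<bar> \<le> C * \<theta> ^ k"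
    using hoelder_onD[OF assms(1)] by blast
  have "\<bar>\<phi> x\<bar> \<le> C + \<bar>\<phi> x\<^sub>0\<bar>" if "x \<in> X" for x using C(4)[OF that x0, of 0] by auto
  then show ?thesis using C by (intro exI[of _ "C + \<bar>\<phi> x\<^sub>0\<bar>"]) auto
qed auto

section \<open>The language of a shift space\<close>

lemma language_eq:
  assumes "shift_space A X"
  shows "language X = {map x [0..<n] | x n. x \<in> X}"
proof (intro equalityI subsetI)
  fix w assume "w \<in> language X"
  then obtain x i n where x: "x \<in> X" "w = map x [i..<i+n]" by (auto simp: language_def)
  have "map x [i..<i+n] = map ((shift ^^ i) x) [0..<n]"
    by (rule nth_equalityI) (auto simp: funpow_shift add.commute)
  then show "w \<in> {map x [0..<n] | x n. x \<in> X}" using x funpow_shift_mem[OF assms] by blast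
next
  fix w assume "w \<in> {map x [0..<n] | x n. x \<in> X}"
  then obtain x n where "x \<in> X" "w = map x [0..<0 + n]" by auto
  then show "w \<in> language X" unfolding language_def by blast
qed

lemma language_prefix:
  assumes "shift_space A X" "u @ v \<in> language X"
  shows "u \<in> language X"
proof -
  obtain x n where x: "x \<in> X" "u @ v = map x [0..<n]" using assms by (auto simp: language_eq)
  have "length u \<le> n" using arg_cong[OF x(2), of length] by simp
  then have "u = map x [0..<length u]" using arg_cong[OF x(2), of "take (length u)"] by (simp add: take_map)
  then show ?thesis using x by (subst language_eq[OF assms(1)]) blast
qed

lemma language_lists:
  assumes "shift_space A X"
  shows "language X \<subseteq> lists A"
  using shift_space_subset[OF assms] by (fastforce simp: language_eq[OF assms] full_shift_def subset_iff)

section \<open>Specification and counting words\<close>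

text \<open>The set of connecting words that work for a pair \<open>(v, w)\<close> can only shrink when \<open>v\<close> is
  extended to the left and \<open>w\<close> to the right. At a pair \<open>(r, s)\<close> where it has minimal size, a single
  connecting word therefore works for all such extensions.\<close>

lemma specification_synchronizing:
  assumes "finite A" "L \<subseteq> lists A" "has_specification L G" "G \<noteq> {}"
  shows "\<exists>r\<in>G. \<exists>s\<in>G. \<exists>c. \<forall>v\<in>G. \<forall>w\<in>G. suffix r v \<and> prefix s w \<longrightarrow> v @ c @ w \<in> G"
proof -
  obtain \<tau> where spec: "\<And>v w. v \<in> G \<Longrightarrow> w \<in> G \<Longrightarrow> \<exists>u\<in>L. length u \<le> \<tau> \<and>
      (\<forall>v' w'. suffix v' v \<and> prefix w' w \<and> v' \<in> G \<and> w' \<in> G \<longrightarrow> v' @ u @ w' \<in> G)"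
    using assms(3) unfolding has_specification_def by blast
  define U where "U = (\<lambda>(v, w). {u \<in> L. length u \<le> \<tau> \<and>
      (\<forall>v' w'. suffix v' v \<and> prefix w' w \<and> v' \<in> G \<and> w' \<in> G \<longrightarrow> v' @ u @ w' \<in> G)})"
  have fin: "finite (U p)" for p
  proof (rule finite_subset)
    show "U p \<subseteq> {xs. set xs \<subseteq> A \<and> length xs \<le> \<tau>}"
      using assms(2) by (auto simp: U_def split: prod.splits)
  qed (use assms(1) finite_lists_length_le in blast)
  obtain r s where rs: "r \<in> G" "s \<in> G" "\<And>v w. v \<in> G \<Longrightarrow> w \<in> G \<Longrightarrow> card (U (r, s)) \<le> card (U (v, w))"
    using ex_has_least_nat[of "\<lambda>p. p \<in> G \<times> G" _ "\<lambda>p. card (U p)"] assms(4) by fastforce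
  obtain c where c: "c \<in> U (r, s)" using spec[OF rs(1,2)] by (auto simp: U_def)
  have "v @ c @ w \<in> G" if vw: "v \<in> G" "w \<in> G" "suffix r v" "prefix s w" for v w
  proof -
    have "U (v, w) \<subseteq> U (r, s)"
      using vw(3,4) by (auto simp: U_def intro: suffix_order.trans prefix_order.trans)
    then have "U (v, w) = U (r, s)" using rs(3)[OF vw(1,2)] fin by (intro card_seteq) auto
    with c have "c \<in> U (v, w)" by simp
    with vw show ?thesis by (auto simp: U_def)
  qed
  with rs show ?thesis by blast
qed

text \<open>The elements of \<open>F\<close> are words of \<open>G\<close> that begin with
  \<open>s\<close> and end with \<open>r\<close>, followed by \<open>c\<close>: at each junction
  \<open>c\<close> then stands between an \<open>r\<close> and an \<open>s\<close>, where it always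
  connects, and the result again begins with \<open>s\<close> and ends with \<open>r\<close>. Any
  word of \<open>G\<close> gets this shape by gluing \<open>s\<close> to its left and
  \<open>r\<close> to its right, which costs boundedly many letters.\<close>

lemma specification_free_concatenation:
  assumes "finite A" "shift_space A X" "G \<subseteq> language X" "has_specification (language X) G"
  shows "\<exists>F \<kappa>. F \<subseteq> language X \<and> (\<forall>a\<in>F. \<forall>b\<in>F. a @ b \<in> F) \<and>
           (\<forall>v\<in>G. \<exists>p t. length p \<le> \<kappa> \<and> length t \<le> \<kappa> \<and> p @ v @ t \<in> F)"
proof (cases "G = {}")
  case False
  obtain r s c where rs: "r \<in> G" "s \<in> G"
    and c: "\<And>v w. v \<in> G \<Longrightarrow> w \<in> G \<Longrightarrow> suffix r v \<Longrightarrow> prefix s w \<Longrightarrow> v @ c @ w \<in> G"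
    using specification_synchronizing[OF assms(1) language_lists[OF assms(2)] assms(4) False] by blast
  obtain \<tau> where spec: "\<And>v w. v \<in> G \<Longrightarrow> w \<in> G \<Longrightarrow> \<exists>u\<in>language X. length u \<le> \<tau> \<and>
      (\<forall>v' w'. suffix v' v \<and> prefix w' w \<and> v' \<in> G \<and> w' \<in> G \<longrightarrow> v' @ u @ w' \<in> G)"
    using assms(4) unfolding has_specification_def by blast
  have glue: "\<exists>u. length u \<le> \<tau> \<and> v @ u @ w \<in> G" if "v \<in> G" "w \<in> G" for v w
    using spec[OF that] that by (meson prefix_order.refl suffix_order.refl)
  define B where "B = {b \<in> G. prefix s b \<and> suffix r b}"
  define F where "F = (\<lambda>b. b @ c) ` B"
  have "F \<subseteq> language X"
  proof
    fix a assume "a \<in> F"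
    then obtain b where "b \<in> G" "suffix r b" "a = b @ c" by (auto simp: F_def B_def)
    \<comment> \<open>The connector \<open>c\<close> at the end may lead out of \<open>G\<close>,
      but not out of the language: \<open>a\<close> is a prefix of \<open>b @ c @ s\<close>.\<close>
    then have "a @ s \<in> language X" using c[of b s] rs(2) assms(3) by auto
    then show "a \<in> language X" by (rule language_prefix[OF assms(2)])
  qed
  moreover have "a @ b \<in> F" if "a \<in> F" "b \<in> F" for a b
  proof -
    obtain a' b' where ab: "a' \<in> B" "b' \<in> B" "a = a' @ c" "b = b' @ c" using \<open>a \<in> F\<close> \<open>b \<in> F\<close> by (auto simp: F_def)
    then have "a' @ c @ b' \<in> B" using c[of a' b']
      by (auto simp: B_def suffix_appendI prefix_prefix)
    then show ?thesis using ab by (auto simp: F_def image_iff)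
  qed
  moreover have "\<exists>p t. length p \<le> (length s + \<tau> + length r + length c) \<and>
     length t \<le> length s + \<tau> + length r + length c \<and> p @ v @ t \<in> F" if v: "v \<in> G" for v
  proof -
    obtain u where u: "length u \<le> \<tau>" "s @ u @ v \<in> G" using glue[OF rs(2) v] by blast
    obtain u' where u': "length u' \<le> \<tau>" "(s @ u @ v) @ u' @ r \<in> G" using glue[OF u(2) rs(1)] by blast
    have "suffix r ((s @ u @ v) @ u' @ r)" by (metis append.assoc suffixI)
    then have "(s @ u @ v) @ u' @ r \<in> B" using u' by (simp add: B_def)
    then have "(s @ u) @ v @ (u' @ r @ c) \<in> F" by (auto simp: F_def image_iff)
    then show ?thesis using u u' by (intro exI[of _ "s @ u"] exI[of _ "u' @ r @ c"]) auto
  qed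
  ultimately show ?thesis by (intro exI[of _ F]) blast
qed auto

text \<open>A word \<open>w\<close> in the ball is recovered from \<open>v\<close> and the set of
  pairs (position, letter of \<open>w\<close>) at which they disagree. A nonempty set of at most
  \<open>k\<close> pairs is the set of entries of a list of length exactly \<open>k\<close>, padded
  by repetition; the empty set is counted by the summand 1.\<close>

lemma card_hamming_ball:
  assumes "finite A" "0 < n" "A \<noteq> {}"
  shows "card {w \<in> lists A. length w = n \<and> hamming_dist v w \<le> k \<and> length v = n} \<le> 1 + (n * card A) ^ k"
proof -
  let ?S = "{w \<in> lists A. length w = n \<and> hamming_dist v w \<le> k \<and> length v = n}"
  let ?T = "{..<n} \<times> A"
  let ?D = "\<lambda>w. {(i, w ! i) | i. i < length v \<and> v ! i \<noteq> w ! i}"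
  have T: "finite ?T" "card ?T = n * card A" using assms by auto
  have "inj_on ?D ?S"
  proof (rule inj_onI)
    fix w w' assume w: "w \<in> ?S" "w' \<in> ?S" "?D w = ?D w'"
    show "w = w'"
    proof (rule nth_equalityI)
      fix i assume i: "i < length w"
      have "(i, w ! i) \<in> ?D w \<longleftrightarrow> (i, w ! i) \<in> ?D w'" "(i, w' ! i) \<in> ?D w \<longleftrightarrow> (i, w' ! i) \<in> ?D w'"
        using w(3) by auto
      then show "w ! i = w' ! i" using i w(1,2) by auto
    qed (use w in auto)
  qed
  moreover have "?D ` ?S \<subseteq> insert {} (set ` {xs. set xs \<subseteq> ?T \<and> length xs = k})"
  proof
    fix D assume "D \<in> ?D ` ?S"
    then obtain w where w: "w \<in> ?S" "D = ?D w" by auto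
    have "D = (\<lambda>i. (i, w ! i)) ` {i. i < length v \<and> v ! i \<noteq> w ! i}" using w by auto
    then have "card D \<le> k" using w card_image_le[of "{i. i < length v \<and> v ! i \<noteq> w ! i}" "\<lambda>i. (i, w ! i)"]
      by (auto simp: hamming_dist_def)
    have D: "D \<subseteq> ?T" using w by auto
    then have "finite D" using T finite_subset by blast
    then obtain xs where xs: "set xs = D" "distinct xs" using finite_distinct_list by blast
    show "D \<in> insert {} (set ` {xs. set xs \<subseteq> ?T \<and> length xs = k})"
    proof (cases "xs = []")
      case False
      have "length xs \<le> k" using xs \<open>card D \<le> k\<close> distinct_card by fastforce
      then have "set (xs @ replicate (k - length xs) (hd xs)) = D"
        "length (xs @ replicate (k - length xs) (hd xs)) = k"
        using xs False by (auto simp: set_replicate_conv_if)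
      then show ?thesis using D by (metis (mono_tags, lifting) image_eqI insertCI mem_Collect_eq)
    qed (use xs in auto)
  qed
  ultimately have "card ?S \<le> card (insert {} (set ` {xs. set xs \<subseteq> ?T \<and> length xs = k}))"
    using finite_lists_length_eq[OF T(1)] by (intro card_inj_on_le[of ?D]) auto
  also have "\<dots> \<le> 1 + card (set ` {xs. set xs \<subseteq> ?T \<and> length xs = k})"
    using card_insert_le_m1 by (simp add: card_insert_if finite_lists_length_eq T)
  also have "\<dots> \<le> 1 + card {xs. set xs \<subseteq> ?T \<and> length xs = k}"
    using finite_lists_length_eq[OF T(1)] by (intro add_left_mono card_image_le) auto
  also have "\<dots> = 1 + (n * card A) ^ k" using card_lists_length_eq[OF T(1)] T by simp
  finally show ?thesis .
qed

lemma card_words_le: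
  assumes "finite A" "A \<noteq> {}" "L \<subseteq> lists A" "G \<subseteq> L" "n > 0"
    and "\<And>w. w \<in> words_of_length L n \<Longrightarrow> \<exists>v\<in>words_of_length G n. hamming_dist v w \<le> k"
  shows "card (words_of_length L n) \<le> card (words_of_length G n) * (1 + (n * card A) ^ k)"
proof -
  have fin: "finite (words_of_length G n)"
    by (rule finite_subset[OF _ finite_lists_length_eq[OF assms(1), of n]])
      (use assms in \<open>auto simp: words_of_length_def\<close>)
  let ?B = "\<lambda>v. {w \<in> lists A. length w = n \<and> hamming_dist v w \<le> k \<and> length v = n}"
  have "finite (?B v)" for v
    by (rule finite_subset[OF _ finite_lists_length_eq[OF assms(1), of n]]) auto
  moreover have "words_of_length L n \<subseteq> (\<Union>v\<in>words_of_length G n. ?B v)"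
    using assms(3,6) by (fastforce simp: words_of_length_def)
  ultimately have "card (words_of_length L n) \<le> card (\<Union>v\<in>words_of_length G n. ?B v)"
    using fin by (intro card_mono) auto
  also have "\<dots> \<le> (\<Sum>v\<in>words_of_length G n. card (?B v))" using fin by (rule card_UN_le)
  also have "\<dots> \<le> (\<Sum>v\<in>words_of_length G n. 1 + (n * card A) ^ k)"
    by (intro sum_mono card_hamming_ball assms)
  finally show ?thesis by simp
qed

lemma pigeonhole_fibre:
  assumes "finite T" "T \<noteq> {}" "f ` S \<subseteq> T"
  shows "\<exists>t\<in>T. card S \<le> card T * card {s\<in>S. f s = t}"
proof (rule ccontr)
  assume "\<not> ?thesis"
  then have "(\<Sum>t\<in>T. card T * card {s\<in>S. f s = t}) < (\<Sum>t\<in>T. card S)"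
    using assms by (intro sum_strict_mono) (auto simp: not_le)
  then have "card T * (\<Sum>t\<in>T. card {s\<in>S. f s = t}) < card T * card S"
    by (simp add: sum_distrib_left)
  then have "(\<Sum>t\<in>T. card {s\<in>S. f s = t}) < card S" by simp
  moreover have "S = (\<Union>t\<in>T. {s\<in>S. f s = t})" using assms(3) by auto
  then have "card S \<le> (\<Sum>t\<in>T. card {s\<in>S. f s = t})" by (metis card_UN_le assms(1))
  ultimately show False by simp
qed

lemma eventually_le_mult_ln:
  fixes g :: "nat \<Rightarrow> nat"
  assumes "(\<lambda>n. real (g n) / ln (real n)) \<longlonglongrightarrow> 0" "e > 0"
  shows "\<forall>\<^sub>F n in sequentially. real (g n) \<le> e * ln (real n)"
  using order_tendstoD(2)[OF assms] eventually_gt_at_top[of 1]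
proof eventually_elim
  case (elim n)
  then show ?case by (simp add: field_simps)
qed

text \<open>If every \<open>words_of_length G n\<close> had at most \<open>K\<close> elements, then
  for large \<open>n\<close> Hamming balls of radius \<open>g n\<close> around them would cover the
  words of length \<open>n\<close> in the language. Such a ball has at most
  \<open>1 + (n * card A) ^ g n\<close> elements, whose logarithm is at most of the order of
  \<open>ln n\<close> squared, so the entropy would vanish.\<close>

lemma card_words_unbounded:
  assumes "finite A" "shift_space A X" "topological_entropy X > 0" "G \<subseteq> language X"
    and g: "(\<lambda>n. real (g n) / ln (real n)) \<longlonglongrightarrow> 0"
    and "hamming_approachable g (language X) G"
  shows "\<exists>n. K < card (words_of_length G n)"
proof (rule ccontr)
  assume "\<not> ?thesis"
  then have K: "card (words_of_length G n) \<le> K" for n by (auto simp: not_less)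
  obtain n0 where n0: "\<And>n w. n \<ge> n0 \<Longrightarrow> w \<in> words_of_length (language X) n \<Longrightarrow>
      \<exists>v\<in>words_of_length G n. hamming_dist v w \<le> g n"
    using assms(6) unfolding hamming_approachable_def by blast
  have "\<forall>\<^sub>F n in sequentially. ln (real (card (words_of_length (language X) n))) / real n
     \<le> (ln (K + 1) + ln 2 + ln n * ln (n * (card A + 1))) / real n"
    using eventually_le_mult_ln[OF g, of 1, OF zero_less_one] eventually_ge_at_top[of n0] eventually_gt_at_top[of 1]
  proof eventually_elim
    case (elim n)
    have "ln (real (card (words_of_length (language X) n))) \<le> ln (K + 1) + ln 2 + ln n * ln (n * (card A + 1))"
    proof (cases "card (words_of_length (language X) n) = 0")
      \<comment> \<open>Here the left-hand side is \<open>ln 0 = 0\<close>, so the right-hand side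
        must be nonnegative; the factor \<open>card A + 1\<close> ensures this even for an empty
        alphabet.\<close>
      case True
      have "real n + real n * real (card A) \<ge> 1" using elim by (simp add: add_increasing2)
      with True show ?thesis using elim by (auto intro!: add_nonneg_nonneg mult_nonneg_nonneg ln_ge_zero)
    next
      case False
      then obtain w where w: "w \<in> words_of_length (language X) n" by (metis all_not_in_conv card.empty)
      have A: "A \<noteq> {}"
        using w language_lists[OF assms(2)] elim by (auto simp: words_of_length_def)
      have c: "card (words_of_length (language X) n) \<le> card (words_of_length G n) * (1 + (n * card A) ^ g n)"
        using elim by (intro card_words_le[OF assms(1) A language_lists[OF assms(2)] assms(4)] n0) auto
      have "(n * card A) ^ g n \<ge> 1" using A assms(1) elim by (auto simp: Suc_le_eq card_gt_0_iff)
      then have "1 + (n * card A) ^ g n \<le> 2 * (n * card A) ^ g n" by simp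
      also have "\<dots> \<le> 2 * (n * (card A + 1)) ^ g n" by (intro mult_left_mono power_mono) auto
      finally have "card (words_of_length G n) * (1 + (n * card A) ^ g n) \<le> (K + 1) * (2 * (n * (card A + 1)) ^ g n)"
        using K[of n] by (intro mult_mono) auto
      with c have "card (words_of_length (language X) n) \<le> (K + 1) * (2 * (n * (card A + 1)) ^ g n)" by linarith
      then have "real (card (words_of_length (language X) n)) \<le> real ((K + 1) * (2 * (n * (card A + 1)) ^ g n))"
        by (simp only: of_nat_le_iff)
      also have "\<dots> = (real K + 1) * (2 * (real n * (card A + 1)) ^ g n)" by (simp add: algebra_simps)
      finally have "ln (real (card (words_of_length (language X) n))) \<le> ln ((real K + 1) * (2 * (real n * (card A + 1)) ^ g n))"
        using False by (intro ln_mono) auto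
      also have "\<dots> = ln (real K + 1) + ln 2 + g n * ln (real n * (card A + 1))"
        using elim by (simp add: ln_mult ln_realpow add_pos_nonneg)
      also have "\<dots> \<le> ln (real K + 1) + ln 2 + ln n * ln (real n * (card A + 1))"
      proof -
        have "real n * (card A + 1) \<ge> 1 * 1" using elim by (intro mult_mono) auto
        then show ?thesis using elim by (intro add_left_mono mult_right_mono) auto
      qed
      finally show ?thesis by (simp add: algebra_simps)
    qed
    then show ?case by (intro divide_right_mono) auto
  qed
  moreover have "(\<lambda>n. (ln (K + 1) + ln 2 + ln (real n) * ln (real n * (real (card A) + 1))) / real n) \<longlonglongrightarrow> 0"
    by real_asymp
  then have "(\<lambda>n. (ln (K + 1) + ln 2 + ln n * ln (n * (card A + 1))) / real n) \<longlonglongrightarrow> 0"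
    by (simp add: algebra_simps)
  then have "limsup (\<lambda>n. ereal ((ln (K + 1) + ln 2 + ln n * ln (n * (card A + 1))) / real n)) = 0"
    unfolding zero_ereal_def by (intro lim_imp_Limsup tendsto_ereal) simp_all
  ultimately have "topological_entropy X \<le> 0"
    unfolding topological_entropy_def
    by (intro order_trans[OF Limsup_mono eq_refl]) (auto elim: eventually_mono)
  then show False using assms(3) by simp
qed

text \<open>Fixing the lengths of both extensions makes the extended words equally long and keeps
  \<open>v\<close> readable in the middle, hence the words distinct. There are (\<kappa> + 1)^2
  pairs of lengths, so more than \<open>K\<close> times that many words of \<open>G\<close> of one
  length suffice.\<close>

lemma many_free_words:
  assumes "finite A" "L \<subseteq> lists A" "G \<subseteq> L" and unb: "\<And>K. \<exists>n. K < card (words_of_length G n)"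
    and F: "\<And>v. v \<in> G \<Longrightarrow> \<exists>p t. length p \<le> \<kappa> \<and> length t \<le> \<kappa> \<and> p @ v @ t \<in> F"
  shows "\<exists>Q m. Q \<subseteq> F \<and> finite Q \<and> (\<forall>q\<in>Q. length q = m) \<and> K < card Q"
proof -
  obtain n where n: "K * card ({..\<kappa>} \<times> {..\<kappa>}) < card (words_of_length G n)" using unb by blast
  obtain p t where pt: "\<And>v. v \<in> G \<Longrightarrow> length (p v) \<le> \<kappa> \<and> length (t v) \<le> \<kappa> \<and> p v @ v @ t v \<in> F"
    using F by metis
  have fin: "finite (words_of_length G n)"
    by (rule finite_subset[OF _ finite_lists_length_eq[OF assms(1), of n]])
      (use assms in \<open>auto simp: words_of_length_def\<close>)
  have "\<exists>ab\<in>{..\<kappa>} \<times> {..\<kappa>}. card (words_of_length G n) \<le> card ({..\<kappa>} \<times> {..\<kappa>}) *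
      card {v\<in>words_of_length G n. (length (p v), length (t v)) = ab}"
    using pt by (intro pigeonhole_fibre) (auto simp: words_of_length_def)
  then obtain a b where "card (words_of_length G n) \<le> card ({..\<kappa>} \<times> {..\<kappa>}) *
      card {v\<in>words_of_length G n. (length (p v), length (t v)) = (a, b)}" (is "_ \<le> _ * card ?V")
    by auto
  then have "K * card ({..\<kappa>} \<times> {..\<kappa>}) < card ?V * card ({..\<kappa>} \<times> {..\<kappa>})" using n by (simp add: mult.commute)
  then have ab: "K < card ?V" by (simp only: mult_less_cancel2)
  let ?f = "\<lambda>v. p v @ v @ t v"
  have "inj_on ?f ?V" by (rule inj_onI) (auto simp: words_of_length_def)
  then have "card (?f ` ?V) = card ?V" by (rule card_image)
  moreover have "finite (?f ` ?V)" using fin by simp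
  ultimately show ?thesis using ab pt
    by (intro exI[of _ "?f ` ?V"] exI[of _ "a + n + b"]) (auto simp: words_of_length_def)
qed

section \<open>Measures on free concatenations\<close>

lemma measurable_funpow_shift:
  assumes "finite A" "shift_space A X"
  shows "(shift ^^ k) \<in> measurable (borel_on A X) (borel_on A X)"
  by (rule measurable_compose_n[OF measurable_shift[OF assms]])

text \<open>The mean of the images of \<rho> under \<open>shift ^^ k\<close> for
  \<open>k < l\<close> is invariant: one more shift turns the summand for \<open>k\<close> into that
  for \<open>k + 1\<close>, and the summand for \<open>l\<close> equals that for 0. Realizing the
  mean as an image of the product of a uniform measure with \<rho> lets Fubini compute its
  integrals.\<close>

lemma cyclic_average:
  fixes \<rho> :: "(nat \<Rightarrow> 'a) measure"
  assumes A: "finite A" "shift_space A X" and "0 < l"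
    and \<rho>: "prob_space \<rho>" "sets \<rho> = sets (borel_on A X)" "distr \<rho> (borel_on A X) (shift ^^ l) = \<rho>"
  shows "\<exists>\<nu>\<in>invariant_measures A X. \<forall>f\<in>borel_measurable (borel_on A X). bounded (f ` X) \<longrightarrow>
    integral\<^sup>L \<nu> f = (\<Sum>k<l. \<integral>x. f ((shift ^^ k) x) \<partial>\<rho>) / l"
proof -
  let ?B = "borel_on A X" and ?U = "uniform_count_measure {..<l}"
  let ?T = "\<lambda>(k, x). (shift ^^ k) x"
  interpret \<rho>: prob_space \<rho> by fact
  interpret U: prob_space ?U using \<open>0 < l\<close> by (intro prob_space_uniform_count_measure) auto
  interpret UR: pair_prob_space ?U \<rho> ..
  have sp: "space \<rho> = X" using sets_eq_imp_space_eq[OF \<rho>(2)] by simp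
  have meas: "(shift ^^ k) \<in> measurable \<rho> ?B" for k
    using measurable_funpow_shift[OF A] measurable_cong_sets[OF \<rho>(2) refl] by blast
  have "?T \<in> measurable (count_space {..<l} \<Otimes>\<^sub>M \<rho>) ?B"
    using meas by (intro measurable_pair_measure_countable1) auto
  then have T: "?T \<in> measurable (?U \<Otimes>\<^sub>M \<rho>) ?B"
    by (subst measurable_cong_sets[OF sets_pair_measure_cong refl])
      (auto simp: sets_uniform_count_measure)
  define \<nu> where "\<nu> = distr (?U \<Otimes>\<^sub>M \<rho>) ?B ?T"
  interpret \<nu>: prob_space \<nu> unfolding \<nu>_def by (rule UR.prob_space_distr[OF T])
  have int: "integral\<^sup>L \<nu> f = (\<Sum>k<l. \<integral>x. f ((shift ^^ k) x) \<partial>\<rho>) / l"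
    if f: "f \<in> borel_measurable ?B" "bounded (f ` X)" for f :: "_ \<Rightarrow> real"
  proof -
    obtain b where b: "\<And>x. x \<in> X \<Longrightarrow> norm (f x) \<le> b" using f(2) by (auto simp: bounded_iff)
    have "integral\<^sup>L \<nu> f = (\<integral>p. f (?T p) \<partial>(?U \<Otimes>\<^sub>M \<rho>))"
      unfolding \<nu>_def by (rule integral_distr[OF T f(1)])
    also have "\<dots> = (\<integral>k. \<integral>x. f (?T (k, x)) \<partial>\<rho> \<partial>?U)"
    proof (rule UR.integral_fst'[symmetric])
      show "integrable (?U \<Otimes>\<^sub>M \<rho>) (\<lambda>p. f (?T p))"
      proof (rule UR.integrable_const_bound[of _ b])
        show "AE p in ?U \<Otimes>\<^sub>M \<rho>. norm (f (?T p)) \<le> b"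
          using b funpow_shift_mem[OF A(2)] by (intro AE_I2) (auto simp: space_pair_measure sp)
        show "(\<lambda>p. f (?T p)) \<in> borel_measurable (?U \<Otimes>\<^sub>M \<rho>)"
          using measurable_compose[OF T f(1)] by simp
      qed
    qed
    also have "\<dots> = (\<Sum>k<l. \<integral>x. f ((shift ^^ k) x) \<partial>\<rho>) / l"
      by (simp add: integral_uniform_count_measure)
    finally show ?thesis .
  qed
  have sets: "sets \<nu> = sets ?B" "space \<nu> = X" by (auto simp: \<nu>_def)
  have shift: "shift \<in> measurable \<nu> \<nu>"
    using measurable_shift[OF A] measurable_cong_sets[OF sets(1) sets(1)] by blast
  have prob: "\<nu>.prob S = (\<Sum>k<l. \<rho>.prob ((shift ^^ k) -` S \<inter> X)) / l" if S: "S \<in> sets ?B" for S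
  proof -
    have "(\<integral>x. indicat_real S ((shift ^^ k) x) \<partial>\<rho>) = \<rho>.prob ((shift ^^ k) -` S \<inter> X)" for k
    proof -
      have "(\<integral>x. indicat_real S ((shift ^^ k) x) \<partial>\<rho>) = (\<integral>x. indicat_real ((shift ^^ k) -` S \<inter> X) x \<partial>\<rho>)"
        by (intro Bochner_Integration.integral_cong) (auto simp: sp indicator_def)
      also have "\<dots> = \<rho>.prob ((shift ^^ k) -` S \<inter> X)"
        using measurable_sets[OF meas S, of k] by (simp add: sp)
      finally show ?thesis .
    qed
    moreover have "\<nu>.prob S = integral\<^sup>L \<nu> (indicator S)"
      using S sets sets.sets_into_space[OF S] by (simp add: Int_absorb2)
    moreover have "bounded (indicator S ` X :: real set)" by (auto simp: bounded_iff indicator_def)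
    ultimately show ?thesis using int[of "indicator S"] S by simp
  qed
  have "distr \<nu> \<nu> shift = \<nu>"
  proof (rule measure_eqI)
    fix S assume "S \<in> sets (distr \<nu> \<nu> shift)"
    then have S: "S \<in> sets ?B" by (simp add: sets)
    let ?a = "\<lambda>k. \<rho>.prob ((shift ^^ k) -` S \<inter> X)"
    have "?a l = measure (distr \<rho> ?B (shift ^^ l)) S" by (simp add: measure_distr[OF meas S] sp)
    also have "\<dots> = ?a 0" using \<rho>(3) sets.sets_into_space[OF S] by (simp add: Int_absorb2)
    finally have a: "?a l = ?a 0" .
    have "\<nu>.prob (shift -` S \<inter> X) = (\<Sum>k<l. ?a (Suc k)) / l"
    proof -
      have "(shift ^^ k) -` (shift -` S \<inter> X) \<inter> X = (shift ^^ Suc k) -` S \<inter> X" for k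
        using funpow_shift_mem[OF A(2)] by auto
      then show ?thesis using prob measurable_sets[OF measurable_shift[OF A] S] by simp
    qed
    also have "(\<Sum>k<l. ?a (Suc k)) = (\<Sum>k<l. ?a k)"
      using sum.lessThan_Suc_shift[of ?a l] sum.lessThan_Suc[of ?a l] a by linarith
    finally have "\<nu>.prob (shift -` S \<inter> X) = \<nu>.prob S" using prob[OF S] by simp
    then show "emeasure (distr \<nu> \<nu> shift) S = emeasure \<nu> S"
      using S by (simp add: emeasure_distr[OF shift] sets \<nu>.emeasure_eq_measure)
  qed simp
  then have "\<nu> \<in> invariant_measures A X"
    using sets shift \<nu>.prob_space_axioms by (simp add: invariant_measures_def)
  then show ?thesis using int by blast
qed

section \<open>Independent blocks and their entropy\<close>

definition concat_blocks :: "nat \<Rightarrow> (nat \<Rightarrow> 'a list) \<Rightarrow> nat \<Rightarrow> 'a" where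
  "concat_blocks l \<omega> = (\<lambda>i. \<omega> (i div l) ! (i mod l))"

lemma concat_blocks_shift:
  assumes "0 < l"
  shows "(shift ^^ l) (concat_blocks l \<omega>) = concat_blocks l (\<lambda>i. \<omega> (Suc i))"
proof
  fix i
  have "(i + l) div l = Suc (i div l)" "(i + l) mod l = i mod l" using assms by auto
  then show "(shift ^^ l) (concat_blocks l \<omega>) i = concat_blocks l (\<lambda>i. \<omega> (Suc i)) i"
    by (simp add: funpow_shift concat_blocks_def)
qed

definition block_measure :: "'a list set \<Rightarrow> (nat \<Rightarrow> 'a list) measure" where
  "block_measure E = PiM UNIV (\<lambda>_. uniform_count_measure E)"

context
  fixes E :: "'a list set" and l :: nat and A :: "'a set" and X
  assumes A: "finite A" "shift_space A X"
    and E: "finite E" "E \<noteq> {}" "0 < l" "\<And>e. e \<in> E \<Longrightarrow> length e = l"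
    and EX: "\<And>\<omega>. (\<And>i. \<omega> i \<in> E) \<Longrightarrow> concat_blocks l \<omega> \<in> X"
begin

interpretation P: product_prob_space "\<lambda>_. uniform_count_measure E" "UNIV :: nat set"
  by (rule product_prob_spaceI) (use E in \<open>simp add: prob_space_uniform_count_measure\<close>)

lemma space_block_measure: "space (block_measure E) = {\<omega>. \<forall>i. \<omega> i \<in> E}"
  by (auto simp: block_measure_def space_PiM space_uniform_count_measure)

lemma prob_space_block_measure: "prob_space (block_measure E)"
  unfolding block_measure_def by (rule P.prob_space_axioms)

lemma measurable_concat_blocks: "concat_blocks l \<in> measurable (block_measure E) (borel_on A X)"
proof (rule measurable_borel_onI[OF A])
  show "concat_blocks l \<in> space (block_measure E) \<rightarrow> X" using EX by (auto simp: space_block_measure)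
  fix w :: "'a list"
  have "concat_blocks l -` cylinder X w \<inter> space (block_measure E) =
     {\<omega> \<in> space (block_measure E). \<forall>i\<in>{..<length w}. \<omega> (i div l) ! (i mod l) = w ! i}"
  proof -
    have "concat_blocks l \<omega> \<in> cylinder X w \<longleftrightarrow> (\<forall>i\<in>{..<length w}. \<omega> (i div l) ! (i mod l) = w ! i)"
      if "\<omega> \<in> space (block_measure E)" for \<omega>
    proof -
      have "concat_blocks l \<omega> \<in> X" using that by (intro EX) (simp add: space_block_measure)
      then show ?thesis by (simp add: cylinder_iff concat_blocks_def Ball_def)
    qed
    then show ?thesis by blast
  qed
  also have "\<dots> \<in> sets (block_measure E)"
  proof (rule sets.sets_Collect_finite_All)
    fix i assume "i \<in> {..<length w}"
    show "{\<omega> \<in> space (block_measure E). \<omega> (i div l) ! (i mod l) = w ! i} \<in> sets (block_measure E)"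
      unfolding block_measure_def
      by (rule sets_Collect_single'[where i = "i div l" and P = "\<lambda>e. e ! (i mod l) = w ! i"]) (auto simp: sets_uniform_count_measure space_uniform_count_measure)
  qed auto
  finally show "concat_blocks l -` cylinder X w \<inter> space (block_measure E) \<in> sets (block_measure E)" .
qed

lemma distr_block_measure_shift:
  "distr (block_measure E) (block_measure E) (\<lambda>\<omega> i. \<omega> (Suc i)) = block_measure E"
  using distr_PiM_reindex[of UNIV "\<lambda>_. uniform_count_measure E" Suc UNIV] E
  by (simp add: block_measure_def prob_space_uniform_count_measure restrict_UNIV)

lemma distr_concat_blocks_invariant:
  defines "\<rho> \<equiv> distr (block_measure E) (borel_on A X) (concat_blocks l)"
  shows "distr \<rho> (borel_on A X) (shift ^^ l) = \<rho>"
proof -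
  have S: "(\<lambda>\<omega> i. \<omega> (Suc i)) \<in> measurable (block_measure E) (block_measure E)"
    unfolding block_measure_def by (rule measurable_PiM_single') (auto simp: space_PiM)
  have "distr \<rho> (borel_on A X) (shift ^^ l) =
     distr (block_measure E) (borel_on A X) ((shift ^^ l) \<circ> concat_blocks l)"
    unfolding \<rho>_def by (rule distr_distr) (auto intro: measurable_funpow_shift A measurable_concat_blocks)
  also have "(shift ^^ l) \<circ> concat_blocks l = concat_blocks l \<circ> (\<lambda>\<omega> i. \<omega> (Suc i))"
    by (simp add: fun_eq_iff comp_def concat_blocks_shift[OF E(3)])
  also have "distr (block_measure E) (borel_on A X) \<dots> =
     distr (distr (block_measure E) (block_measure E) (\<lambda>\<omega> i. \<omega> (Suc i))) (borel_on A X) (concat_blocks l)"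
    by (rule distr_distr[symmetric]) (auto intro: measurable_concat_blocks S)
  finally show ?thesis by (simp add: distr_block_measure_shift \<rho>_def)
qed

text \<open>Each block that lies entirely inside the window read by \<open>w\<close> is prescribed
  by \<open>w\<close>, which has probability at most \<open>1 / card E\<close>; the blocks are
  independent.\<close>

lemma concat_blocks_cylinder_le:
  assumes "k < l"
  shows "measure (distr (block_measure E) (borel_on A X) (concat_blocks l)) ((shift ^^ k) -` cylinder X w \<inter> X)
     \<le> (1 / card E) ^ (length w div l - 1)" (is "measure ?\<rho> ?C \<le> _")
proof -
  \<comment> \<open>The window covers the positions from \<open>k\<close> to
    \<open>k + length w - 1\<close>, and block \<open>j\<close> those from \<open>j * l\<close> to
    \<open>(j + 1) * l - 1\<close>. So the blocks 1 to \<open>length w div l - 1\<close> lie inside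
    it for every phase \<open>k < l\<close>, whereas block 0 may be cut.\<close>
  let ?J = "{1..length w div l - 1}"
  define D where "D = (\<lambda>j. {e\<in>E. \<forall>m<l. e ! m = w ! (j * l + m - k)})"
  have sets: "?C \<in> sets (borel_on A X)"
    using measurable_sets[OF measurable_funpow_shift[OF A] cylinder_borel_on[OF A(2)]] by simp
  have D1: "card (D j) \<le> 1" for j
  proof -
    have "e = e'" if "e \<in> D j" "e' \<in> D j" for e e'
      using that E(4) by (intro nth_equalityI) (auto simp: D_def)
    then show ?thesis using E(1) by (auto simp: card_le_Suc0_iff_eq D_def)
  qed
  have "concat_blocks l -` ?C \<inter> space (block_measure E) \<subseteq> {\<omega>\<in>space (block_measure E). \<forall>j\<in>?J. \<omega> j \<in> D j}"
  proof (intro subsetI CollectI conjI ballI)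
    fix \<omega> j assume *: "\<omega> \<in> concat_blocks l -` ?C \<inter> space (block_measure E)" and j: "j \<in> ?J"
    then have \<omega>: "\<omega> \<in> space (block_measure E)" "(shift ^^ k) (concat_blocks l \<omega>) \<in> cylinder X w" by auto
    have "\<omega> j ! m = w ! (j * l + m - k)" if m: "m < l" for m
    proof -
    have "j + 1 \<le> length w div l" using j by auto
    then have "(j + 1) * l \<le> length w" by (metis div_times_less_eq_dividend mult_le_mono1 order_trans)
    then have lt: "j * l + m - k < length w" using m by auto
    have "1 * l \<le> j * l" using j by (intro mult_le_mono1) auto
    then have k: "k \<le> j * l + m" using \<open>k < l\<close> by linarith
    have "map ((shift ^^ k) (concat_blocks l \<omega>)) [0..<length w] = w" using \<omega> by (simp add: cylinder_def)
    then have "w ! (j * l + m - k) = (shift ^^ k) (concat_blocks l \<omega>) (j * l + m - k)"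
      using lt by (metis add_0 nth_map_upt diff_zero)
    also have "\<dots> = \<omega> j ! m" using k m by (simp add: funpow_shift concat_blocks_def)
    finally show ?thesis by simp
    qed
    then show "\<omega> j \<in> D j" using \<omega> by (simp add: D_def space_block_measure)
  qed simp
  moreover have "{\<omega>\<in>space (block_measure E). \<forall>j\<in>?J. \<omega> j \<in> D j} \<in> sets (block_measure E)"
  proof (rule sets.sets_Collect_finite_All)
    fix j
    show "{\<omega> \<in> space (block_measure E). \<omega> j \<in> D j} \<in> sets (block_measure E)"
      unfolding block_measure_def
      by (rule sets_Collect_single'[where i = j and P = "\<lambda>e. e \<in> D j"])
        (auto simp: sets_uniform_count_measure space_uniform_count_measure)
  qed simp
  ultimately have "emeasure ?\<rho> ?C \<le> emeasure (block_measure E) {\<omega>\<in>space (block_measure E). \<forall>j\<in>?J. \<omega> j \<in> D j}"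
    unfolding emeasure_distr[OF measurable_concat_blocks sets] by (rule emeasure_mono)
  also have "\<dots> = (\<Prod>j\<in>?J. emeasure (uniform_count_measure E) (D j))"
    unfolding block_measure_def by (rule P.emeasure_PiM_Collect) (auto simp: sets_uniform_count_measure D_def)
  also have "\<dots> \<le> (\<Prod>j\<in>?J. ennreal (1 / card E))"
  proof (rule prod_mono_ennreal)
    fix j
    have "real (card (D j)) / real (card E) \<le> 1 / card E"
      using D1[of j] by (intro divide_right_mono) auto
    then show "emeasure (uniform_count_measure E) (D j) \<le> ennreal (1 / card E)"
      using E(1) by (subst emeasure_uniform_count_measure) (auto simp: D_def intro!: ennreal_leI)
  qed
  also have "\<dots> = ennreal ((1 / card E) ^ (length w div l - 1))" by (simp add: ennreal_power)
  finally show ?thesis unfolding measure_def by (simp add: enn2real_leI)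
qed

end

text \<open>The entropy is the mean of \<open>- ln (prob B)\<close>, and every block of positive
  mass contributes a value of at least \<open>- ln \<delta>\<close>. Disjointness and the union are
  assumed in place of \<open>partition_on\<close> because a dynamical join may contain the empty
  set.\<close>

lemma partition_entropy_ge:
  assumes "prob_space \<nu>" "finite Q" "Q \<subseteq> sets \<nu>" "disjoint Q" "\<Union>Q = space \<nu>" "0 < \<delta>"
    and "\<And>B. B \<in> Q \<Longrightarrow> measure \<nu> B \<le> \<delta>"
  shows "- ln \<delta> \<le> partition_entropy \<nu> Q"
proof -
  interpret prob_space \<nu> by fact
  have "(\<Sum>B\<in>Q. prob B) = prob (\<Union>Q)"
    using finite_measure_finite_Union[of Q "\<lambda>B. B"] assms by (simp add: disjoint_def disjoint_family_on_def subset_eq)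
  then have one: "(\<Sum>B\<in>Q. prob B) = 1" using assms(5) prob_space by simp
  have "- ln \<delta> = (\<Sum>B\<in>Q. prob B) * (- ln \<delta>)" unfolding one by simp
  also have "\<dots> = (\<Sum>B\<in>Q. - prob B * ln \<delta>)" unfolding sum_distrib_right by simp
  also have "\<dots> \<le> (\<Sum>B\<in>Q. - prob B * ln (prob B))"
  proof (rule sum_mono)
    fix B assume "B \<in> Q"
    show "- prob B * ln \<delta> \<le> - prob B * ln (prob B)"
    proof (cases "prob B = 0")
      case False
      then have "0 < prob B" by (simp add: measure_nonneg order_less_le)
      then have "ln (prob B) \<le> ln \<delta>" using assms(7)[OF \<open>B \<in> Q\<close>] by (intro ln_mono) auto
      then show ?thesis by (simp add: mult_left_mono measure_nonneg)
    qed simp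
  qed
  finally show ?thesis by (simp add: partition_entropy_def)
qed

text \<open>The partition by the first letter suffices: its joins consist of cylinders of length
  \<open>N\<close>, and uniformly small cylinders force large entropy.\<close>

lemma measure_entropy_ge:
  assumes A: "finite A" "shift_space A X" and \<nu>: "\<nu> \<in> invariant_measures A X"
    and c: "1 \<le> c" "0 < l"
    and small: "\<And>w. measure \<nu> (cylinder X w) \<le> (1 / c) ^ (length w div l - 1)"
  shows "ereal (ln c / real l) \<le> measure_entropy \<nu> shift"
proof -
  have sets: "sets \<nu> = sets (borel_on A X)" and prob: "prob_space \<nu>"
    using \<nu> by (auto simp: invariant_measures_def)
  have sp: "space \<nu> = X" using sets_eq_imp_space_eq[OF sets] by simp
  have XA: "x i \<in> A" if "x \<in> X" for x i
    using shift_space_subset[OF A(2)] that by (auto simp: full_shift_def)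
  \<comment> \<open>Letters at which no point of \<open>X\<close> starts give empty cylinders, which
    \<open>partition_on\<close> excludes.\<close>
  define P where "P = (\<lambda>a. cylinder X [a]) ` A - {{}}"
  have "\<Union>P = X"
  proof
    show "X \<subseteq> \<Union>P"
    proof
      fix x assume "x \<in> X"
      then have "x \<in> cylinder X [x 0]" "x 0 \<in> A" using XA by (auto simp: cylinder_iff)
      then show "x \<in> \<Union>P" unfolding P_def by blast
    qed
  qed (auto simp: P_def cylinder_def)
  then have P: "finite_measurable_partition \<nu> P"
    unfolding finite_measurable_partition_def partition_on_def
    using A(1) cylinder_borel_on[OF A(2)] XA
    by (auto simp: P_def sets sp cylinder_iff disjoint_def)
  have join: "- ln ((1 / c) ^ (N div l - 1)) \<le> partition_entropy \<nu> (dynamical_join \<nu> shift P N)" (is "_ \<le> partition_entropy \<nu> ?Q") for N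
  proof (rule partition_entropy_ge[OF prob])
    have cyl: "\<exists>w. set w \<subseteq> A \<and> length w = N \<and> B = cylinder X w" if B: "B \<in> ?Q" for B
    proof -
      obtain C where C: "B = {x \<in> X. \<forall>i<N. (shift ^^ i) x \<in> C i}" "\<forall>i<N. C i \<in> P"
        using B by (auto simp: dynamical_join_def sp)
      have "\<forall>i\<in>{..<N}. \<exists>a\<in>A. C i = cylinder X [a]" using C(2) by (auto simp: P_def)
      then obtain a where a: "\<forall>i\<in>{..<N}. a i \<in> A \<and> C i = cylinder X [a i]" by metis
      have "B = cylinder X (map a [0..<N])"
        unfolding C(1) using a funpow_shift_mem[OF A(2)]
        by (auto simp: cylinder_iff funpow_shift)
      then show ?thesis using a by (intro exI[of _ "map a [0..<N]"]) auto
    qed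
    show "finite ?Q"
    proof (rule finite_subset)
      show "?Q \<subseteq> cylinder X ` {w. set w \<subseteq> A \<and> length w = N}" using cyl by blast
    qed (simp add: finite_lists_length_eq A(1))
    show "?Q \<subseteq> sets \<nu>" using cyl cylinder_borel_on[OF A(2)] sets by fastforce
    have "B = B'" if "B \<in> ?Q" "B' \<in> ?Q" "x \<in> B" "x \<in> B'" for B B' x
    proof -
      obtain w w' where w: "length w = N" "B = cylinder X w" "length w' = N" "B' = cylinder X w'"
        using cyl \<open>B \<in> ?Q\<close> \<open>B' \<in> ?Q\<close> by metis
      then have "w = w'" using that(3,4) by (intro nth_equalityI) (auto simp: cylinder_iff)
      then show ?thesis using w by simp
    qed
    then show "disjoint ?Q" unfolding disjoint_def by blast
    show "\<Union>?Q = space \<nu>"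
    proof
      show "\<Union>?Q \<subseteq> space \<nu>" by (auto simp: dynamical_join_def)
      show "space \<nu> \<subseteq> \<Union>?Q"
      proof
        fix x assume x: "x \<in> space \<nu>"
        have in_cyl: "(shift ^^ i) x \<in> cylinder X [x i]" for i
          using x funpow_shift_mem[OF A(2), of x i] by (simp add: sp cylinder_iff funpow_shift)
        moreover have "cylinder X [x i] \<in> P" for i
          using XA x in_cyl[of i] by (auto simp: P_def sp)
        ultimately show "x \<in> \<Union>?Q"
          using x unfolding dynamical_join_def by (intro UnionI[of "{y \<in> space \<nu>. \<forall>i<N. (shift ^^ i) y \<in> cylinder X [x i]}"]) auto
      qed
    qed
    show "0 < (1 / c) ^ (N div l - 1)" using c by simp
    show "measure \<nu> B \<le> (1 / c) ^ (N div l - 1)" if "B \<in> ?Q" for B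
      using cyl[OF that] small by auto
  qed
  \<comment> \<open>Rounding down and the missing block together cost at most 2, which disappears in
    the limit.\<close>
  have "ereal (ln c * (N / l - 2) / N) \<le> ereal (partition_entropy \<nu> (dynamical_join \<nu> shift P N) / N)" for N :: nat
  proof -
    have "real N / l \<le> real (N div l) + 1"
    proof -
      have "N \<le> (N div l + 1) * l" using c(2) by (metis Suc_eq_plus1 dividend_less_div_times less_imp_le mult.commute mult_Suc)
      then have "real N \<le> (real (N div l) + 1) * l" by (metis of_nat_1 of_nat_add of_nat_le_iff of_nat_mult)
      then show ?thesis using c(2) by (simp add: field_simps)
    qed
    then have "N / l - 2 \<le> real (N div l - 1)" by linarith
    then have "ln c * (N / l - 2) \<le> ln c * real (N div l - 1)" using c by (intro mult_left_mono) auto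
    also have "\<dots> = - ln ((1 / c) ^ (N div l - 1))" using c by (simp add: ln_realpow ln_div)
    also have "\<dots> \<le> partition_entropy \<nu> (dynamical_join \<nu> shift P N)" by (rule join)
    finally show ?thesis by (simp add: divide_right_mono)
  qed
  then have "limsup (\<lambda>N::nat. ereal (ln c * (N / l - 2) / N)) \<le> entropy_wrt \<nu> shift P"
    unfolding entropy_wrt_def by (intro Limsup_mono always_eventually allI)
  moreover have "(\<lambda>N::nat. ln c * (N / l - 2) / N) \<longlonglongrightarrow> ln c * inverse (real l)"
    using c(2) by real_asymp
  then have "limsup (\<lambda>N::nat. ereal (ln c * (N / l - 2) / N)) = ereal (ln c / l)"
    unfolding divide_inverse[of "ln c" "real l"] by (intro lim_imp_Limsup tendsto_ereal) simp_all
  ultimately have "ereal (ln c / l) \<le> entropy_wrt \<nu> shift P" by simp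
  also have "\<dots> \<le> measure_entropy \<nu> shift"
    unfolding measure_entropy_def using P by (intro SUP_upper) simp
  finally show ?thesis .
qed

text \<open>The cylinder bound holds in every phase, so it passes to the average over the phases.
  The phases of one block add up to a Birkhoff sum of length \<open>l\<close>, hence
  \<open>l\<close> times the integral is the expectation of sums that are all at least
  \<open>s\<close>.\<close>

lemma block_code_measure:
  fixes \<phi> :: "(nat \<Rightarrow> 'a) \<Rightarrow> real"
  assumes A: "finite A" "shift_space A X"
    and E: "finite E" "E \<noteq> {}" "0 < l" "\<And>e. e \<in> E \<Longrightarrow> length e = l"
    and EX: "\<And>\<omega>. (\<And>i. \<omega> i \<in> E) \<Longrightarrow> concat_blocks l \<omega> \<in> X"
    and \<phi>: "\<phi> \<in> borel_measurable (borel_on A X)" "\<And>x. x \<in> X \<Longrightarrow> \<bar>\<phi> x\<bar> \<le> b"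
    and s: "\<And>\<omega>. (\<And>i. \<omega> i \<in> E) \<Longrightarrow> s \<le> (\<Sum>k<l. \<phi> ((shift ^^ k) (concat_blocks l \<omega>)))"
  shows "\<exists>\<nu>\<in>invariant_measures A X. ereal (ln (card E) / real l) \<le> measure_entropy \<nu> shift \<and> s / l \<le> integral\<^sup>L \<nu> \<phi>"
proof -
  let ?P = "block_measure E" and ?B = "borel_on A X"
  define \<rho> where "\<rho> = distr ?P ?B (concat_blocks l)"
  interpret P: prob_space ?P by (rule prob_space_block_measure[OF A E EX])
  note meas = measurable_concat_blocks[OF A E EX]
  interpret \<rho>: prob_space \<rho> unfolding \<rho>_def by (rule P.prob_space_distr[OF meas])
  have inv: "distr \<rho> ?B (shift ^^ l) = \<rho>"
    unfolding \<rho>_def by (rule distr_concat_blocks_invariant[OF A E EX])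
  obtain \<nu> where \<nu>: "\<nu> \<in> invariant_measures A X" and
    int: "\<And>f. f \<in> borel_measurable ?B \<Longrightarrow> bounded (f ` X) \<Longrightarrow>
       integral\<^sup>L \<nu> f = (\<Sum>k<l. \<integral>x. f ((shift ^^ k) x) \<partial>\<rho>) / l"
    using cyclic_average[OF A E(3) \<rho>.prob_space_axioms _ inv] unfolding \<rho>_def by auto
  have sp: "space \<rho> = X" by (simp add: \<rho>_def)
  have shift\<rho>: "(shift ^^ k) \<in> measurable \<rho> ?B" for k
    using measurable_funpow_shift[OF A] by (simp add: \<rho>_def)
  have sets: "sets \<nu> = sets ?B" using \<nu> by (simp add: invariant_measures_def)
  have "measure \<nu> (cylinder X w) \<le> (1 / card E) ^ (length w div l - 1)" for w
  proof -
    have cyl: "cylinder X w \<in> sets ?B" by (rule cylinder_borel_on[OF A(2)])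
    have "(\<integral>x. indicat_real (cylinder X w) ((shift ^^ k) x) \<partial>\<rho>) \<le> (1 / card E) ^ (length w div l - 1)" if "k < l" for k
    proof -
      have "(\<integral>x. indicat_real (cylinder X w) ((shift ^^ k) x) \<partial>\<rho>) = (\<integral>x. indicat_real ((shift ^^ k) -` cylinder X w \<inter> X) x \<partial>\<rho>)"
        by (intro Bochner_Integration.integral_cong) (auto simp: sp indicator_def)
      also have "\<dots> = \<rho>.prob ((shift ^^ k) -` cylinder X w \<inter> X)"
        using measurable_sets[OF shift\<rho> cyl, of k] by (simp add: sp)
      also have "\<dots> \<le> (1 / card E) ^ (length w div l - 1)"
        unfolding \<rho>_def by (rule concat_blocks_cylinder_le[OF A E EX that])
      finally show ?thesis .
    qed
    then have "(\<Sum>k<l. \<integral>x. indicat_real (cylinder X w) ((shift ^^ k) x) \<partial>\<rho>) / l \<le> (\<Sum>k<l. (1 / card E) ^ (length w div l - 1)) / l"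
      by (intro divide_right_mono sum_mono) auto
    also have "\<dots> = (1 / card E) ^ (length w div l - 1)" using E(3) by simp
    also have "(\<Sum>k<l. \<integral>x. indicat_real (cylinder X w) ((shift ^^ k) x) \<partial>\<rho>) / l = integral\<^sup>L \<nu> (indicat_real (cylinder X w))"
      by (rule int[symmetric]) (use cyl in \<open>auto simp: bounded_iff indicator_def\<close>)
    also have "\<dots> = measure \<nu> (cylinder X w)"
      using cyl sets sets.sets_into_space[of "cylinder X w" \<nu>] by (simp add: Int_absorb2)
    finally show ?thesis .
  qed
  then have "ereal (ln (card E) / real l) \<le> measure_entropy \<nu> shift"
    using E by (intro measure_entropy_ge[OF A \<nu>]) (auto simp: Suc_le_eq card_gt_0_iff)
  moreover have "s / l \<le> integral\<^sup>L \<nu> \<phi>"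
  proof -
    have comp: "(\<lambda>\<omega>. \<phi> ((shift ^^ k) (concat_blocks l \<omega>))) \<in> borel_measurable ?P" for k
      using measurable_compose[OF meas measurable_compose[OF measurable_funpow_shift[OF A] \<phi>(1)]] .
    have intk: "integrable ?P (\<lambda>\<omega>. \<phi> ((shift ^^ k) (concat_blocks l \<omega>)))" for k
    proof (rule P.integrable_const_bound[OF _ comp])
      show "AE \<omega> in ?P. norm (\<phi> ((shift ^^ k) (concat_blocks l \<omega>))) \<le> b"
        using \<phi>(2) EX funpow_shift_mem[OF A(2)]
        by (intro AE_I2) (simp add: space_block_measure[OF A E EX])
    qed
    have "(\<integral>x. \<phi> ((shift ^^ k) x) \<partial>\<rho>) = (\<integral>\<omega>. \<phi> ((shift ^^ k) (concat_blocks l \<omega>)) \<partial>?P)" for k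
      unfolding \<rho>_def by (rule integral_distr[OF meas measurable_compose[OF measurable_funpow_shift[OF A] \<phi>(1)]])
    then have "(\<Sum>k<l. \<integral>x. \<phi> ((shift ^^ k) x) \<partial>\<rho>) = (\<integral>\<omega>. (\<Sum>k<l. \<phi> ((shift ^^ k) (concat_blocks l \<omega>))) \<partial>?P)"
      using intk by simp
    also have "\<dots> \<ge> s"
    proof (rule P.integral_ge_const)
      show "AE \<omega> in ?P. s \<le> (\<Sum>k<l. \<phi> ((shift ^^ k) (concat_blocks l \<omega>)))"
        using s by (intro AE_I2) (simp add: space_block_measure[OF A E EX])
    qed (use intk in simp)
    finally have "s / l \<le> (\<Sum>k<l. \<integral>x. \<phi> ((shift ^^ k) x) \<partial>\<rho>) / l" by (rule divide_right_mono) simp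
    also have "\<dots> = integral\<^sup>L \<nu> \<phi>"
      by (rule int[symmetric, OF \<phi>(1)]) (use \<phi>(2) in \<open>auto simp: bounded_iff\<close>)
    finally show ?thesis .
  qed
  ultimately show ?thesis using \<nu> by blast
qed

text \<open>By invariance all summands of the Birkhoff sum have the same integral. This turns a
  bound on the sums into one on the supremum of the integrals.\<close>

lemma invariant_integral_le:
  fixes \<phi> :: "(nat \<Rightarrow> 'a) \<Rightarrow> real"
  assumes A: "finite A" "shift_space A X" and \<mu>: "\<mu> \<in> invariant_measures A X"
    and \<phi>: "\<phi> \<in> borel_measurable (borel_on A X)" "\<And>x. x \<in> X \<Longrightarrow> \<bar>\<phi> x\<bar> \<le> b"
    and c: "\<And>x. x \<in> X \<Longrightarrow> (\<Sum>k<n. \<phi> ((shift ^^ k) x)) \<le> c"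
  shows "n * integral\<^sup>L \<mu> \<phi> \<le> c"
proof -
  interpret prob_space \<mu> using \<mu> by (simp add: invariant_measures_def)
  have sets: "sets \<mu> = sets (borel_on A X)" and inv: "distr \<mu> \<mu> shift = \<mu>"
    and shift: "shift \<in> measurable \<mu> \<mu>"
    using \<mu> by (auto simp: invariant_measures_def)
  have sp: "space \<mu> = X" using sets_eq_imp_space_eq[OF sets] by simp
  have \<phi>\<mu>: "\<phi> \<in> borel_measurable \<mu>" using \<phi>(1) measurable_cong_sets[OF sets refl] by blast
  have sk: "(shift ^^ k) \<in> measurable \<mu> \<mu>" for k by (rule measurable_compose_n[OF shift])
  have ints: "integrable \<mu> (\<lambda>x. \<phi> ((shift ^^ k) x))" for k
  proof (rule integrable_const_bound[OF _ measurable_compose[OF sk \<phi>\<mu>]])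
    show "AE x in \<mu>. norm (\<phi> ((shift ^^ k) x)) \<le> b"
      using \<phi>(2) funpow_shift_mem[OF A(2)] by (intro AE_I2) (simp add: sp)
  qed
  have eq: "(\<integral>x. \<phi> ((shift ^^ k) x) \<partial>\<mu>) = integral\<^sup>L \<mu> \<phi>" for k
  proof (induction k)
    case (Suc k)
    have "(\<integral>x. \<phi> ((shift ^^ k) x) \<partial>\<mu>) = (\<integral>x. \<phi> ((shift ^^ k) x) \<partial>(distr \<mu> \<mu> shift))" by (simp add: inv)
    also have "\<dots> = (\<integral>x. \<phi> ((shift ^^ k) (shift x)) \<partial>\<mu>)"
      by (rule integral_distr[OF shift measurable_compose[OF sk \<phi>\<mu>]])
    finally show ?case using Suc by (simp add: funpow_swap1)
  qed simp
  have "n * integral\<^sup>L \<mu> \<phi> = (\<integral>x. (\<Sum>k<n. \<phi> ((shift ^^ k) x)) \<partial>\<mu>)" using ints by (simp add: eq)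
  also have "\<dots> \<le> c" using c ints by (intro integral_le_const AE_I2) (auto simp: sp)
  finally show ?thesis .
qed

section \<open>Birkhoff sums and inserted words\<close>

text \<open>Between two consecutive disagreements the orbits shadow each other, so each disagreement
  contributes at most a geometric series to the difference of the Birkhoff sums.\<close>

lemma birkhoff_sum_diff_le:
  fixes \<phi> :: "(nat \<Rightarrow> 'a) \<Rightarrow> real"
  assumes X: "shift_space A X" "x \<in> X" "y \<in> X"
    and C: "0 \<le> C" "0 < \<theta>" "\<theta> < 1"
    and h: "\<And>x y k. x \<in> X \<Longrightarrow> y \<in> X \<Longrightarrow> (\<forall>i<k. x i = y i) \<Longrightarrow> \<bar>\<phi> x - \<phi> y\<bar> \<le> C * \<theta> ^ k"
    and D: "card {i. i < N \<and> x i \<noteq> y i} \<le> d"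
  shows "\<bar>(\<Sum>i<N. \<phi> ((shift ^^ i) x)) - (\<Sum>i<N. \<phi> ((shift ^^ i) y))\<bar> \<le> (real d + 1) * (C / (1 - \<theta>))"
proof -
  \<comment> \<open>\<open>N\<close> acts as one more disagreement, because nothing is known about
    the orbits from there on; it accounts for the \<open>+ 1\<close> in the bound.\<close>
  let ?D = "insert N {i. i < N \<and> x i \<noteq> y i}"
  have pt: "\<bar>\<phi> ((shift ^^ i) x) - \<phi> ((shift ^^ i) y)\<bar> \<le> (\<Sum>e\<in>?D. if i \<le> e then C * \<theta> ^ (e - i) else 0)" if "i < N" for i
  proof -
    define e where "e = (LEAST e. e \<in> ?D \<and> i \<le> e)"
    have "N \<in> ?D \<and> i \<le> N" using that by simp
    then have e: "e \<in> ?D \<and> i \<le> e" unfolding e_def by (rule LeastI)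
    have "x (j + i) = y (j + i)" if j: "j < e - i" for j
    proof (rule ccontr)
      assume "x (j + i) \<noteq> y (j + i)"
      moreover have "j + i < N" using j e by auto
      ultimately have "e \<le> j + i" unfolding e_def by (intro Least_le) auto
      then show False using j by simp
    qed
    then have "\<bar>\<phi> ((shift ^^ i) x) - \<phi> ((shift ^^ i) y)\<bar> \<le> C * \<theta> ^ (e - i)"
      using X by (intro h funpow_shift_mem[OF X(1)]) (auto simp: funpow_shift)
    also have "\<dots> = (if i \<le> e then C * \<theta> ^ (e - i) else 0)" using e by simp
    also have "\<dots> \<le> (\<Sum>e\<in>?D. if i \<le> e then C * \<theta> ^ (e - i) else 0)"
      using e C by (intro member_le_sum) auto
    finally show ?thesis .
  qed
  have geo: "(\<Sum>i<N. if i \<le> e then C * \<theta> ^ (e - i) else 0) \<le> C / (1 - \<theta>)" for e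
  proof -
    have "(\<Sum>i<N. if i \<le> e then C * \<theta> ^ (e - i) else 0) = (\<Sum>i\<in>{i. i < N \<and> i \<le> e}. C * \<theta> ^ (e - i))"
      by (intro sum.mono_neutral_cong_right) auto
    also have "\<dots> \<le> (\<Sum>i\<le>e. C * \<theta> ^ (e - i))" using C by (intro sum_mono2) auto
    also have "\<dots> = (\<Sum>i<Suc e. C * \<theta> ^ (Suc e - Suc i))" by (simp only: lessThan_Suc_atMost diff_Suc_Suc)
    also have "\<dots> = (\<Sum>i<Suc e. C * \<theta> ^ i)" by (rule sum.nat_diff_reindex)
    also have "\<dots> = C * (\<Sum>i<Suc e. \<theta> ^ i)" by (simp only: sum_distrib_left)
    also have "(\<Sum>i<Suc e. \<theta> ^ i) \<le> 1 / (1 - \<theta>)"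
      using sum_le_suminf[OF summable_geometric, of \<theta> "{..<Suc e}"] C suminf_geometric[of \<theta>] by simp
    finally show ?thesis using C by (simp add: mult_left_mono)
  qed
  have "\<bar>(\<Sum>i<N. \<phi> ((shift ^^ i) x)) - (\<Sum>i<N. \<phi> ((shift ^^ i) y))\<bar> = \<bar>\<Sum>i<N. \<phi> ((shift ^^ i) x) - \<phi> ((shift ^^ i) y)\<bar>"
    by (simp add: sum_subtractf)
  also have "\<dots> \<le> (\<Sum>i<N. \<bar>\<phi> ((shift ^^ i) x) - \<phi> ((shift ^^ i) y)\<bar>)" by (rule sum_abs)
  also have "\<dots> \<le> (\<Sum>i<N. \<Sum>e\<in>?D. if i \<le> e then C * \<theta> ^ (e - i) else 0)" by (intro sum_mono pt) auto
  also have "\<dots> = (\<Sum>e\<in>?D. \<Sum>i<N. if i \<le> e then C * \<theta> ^ (e - i) else 0)" by (rule sum.swap)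
  also have "\<dots> \<le> (\<Sum>e\<in>?D. C / (1 - \<theta>))" by (intro sum_mono geo)
  also have "\<dots> = card ?D * (C / (1 - \<theta>))" by simp
  also have "card ?D \<le> d + 1" using D by (simp add: card_insert_if)
  then have "card ?D * (C / (1 - \<theta>)) \<le> (real d + 1) * (C / (1 - \<theta>))"
    using C by (intro mult_right_mono divide_nonneg_nonneg) linarith+
  finally show ?thesis .
qed

section \<open>Counting the cuts that lead to one word\<close>

lemma sum_lessThan_add:
  fixes f :: "nat \<Rightarrow> 'b::comm_monoid_add"
  shows "(\<Sum>i<a + b. f i) = (\<Sum>i<a. f i) + (\<Sum>i<b. f (a + i))"
  by (induction b) (auto simp: add.assoc)

text \<open>Applying the hypothesis to the least element of a fibre bounds the whole fibre. Only
  coincidences with a later index are counted, which in the application means that the second cut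
  lies in the tail of the first.\<close>

lemma card_image_ge:
  fixes J :: "nat set"
  assumes "finite J" "\<And>j. j \<in> J \<Longrightarrow> card {i\<in>J. j \<le> i \<and> f i = f j} \<le> (B::nat)"
  shows "card J \<le> B * card (f ` J)"
proof -
  have le: "card {i\<in>J. f i = y} \<le> B" if y: "y \<in> f ` J" for y
  proof -
    define j where "j = (LEAST j. j \<in> J \<and> f j = y)"
    have "\<exists>j. j \<in> J \<and> f j = y" using y by auto
    then have j: "j \<in> J \<and> f j = y" unfolding j_def by (rule LeastI_ex)
    have "{i\<in>J. f i = y} \<subseteq> {i\<in>J. j \<le> i \<and> f i = f j}" using j by (auto simp: j_def intro: Least_le)
    then have "card {i\<in>J. f i = y} \<le> card {i\<in>J. j \<le> i \<and> f i = f j}" using assms(1) by (intro card_mono) auto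
    also have "\<dots> \<le> B" using j by (intro assms(2)) simp
    finally show ?thesis .
  qed
  have "card J = card (\<Union>y\<in>f ` J. {i\<in>J. f i = y})" by (rule arg_cong[of _ _ card]) auto
  also have "\<dots> \<le> (\<Sum>y\<in>f ` J. card {i\<in>J. f i = y})" using assms(1) by (intro card_UN_le) auto
  also have "\<dots> \<le> (\<Sum>y\<in>f ` J. B)" by (intro sum_mono le)
  finally show ?thesis by (simp add: mult.commute)
qed

text \<open>If the words for two cuts \<open>j \<le> i\<close> agree, the insertion \<open>q i\<close> must sit inside the copy of the
  tail of \<open>x\<close> belonging to the cut \<open>j\<close>. By the choice of \<open>q i\<close> this copy has an error there, and
  it has at most \<open>d\<close> errors.\<close>

lemma card_same_word_le:
  fixes x :: "nat \<Rightarrow> 'a" and p1 v1 t1 q p2 v2 t2 :: "nat \<Rightarrow> 'a list"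
  defines "W \<equiv> \<lambda>j. p1 j @ v1 j @ t1 j @ q j @ p2 j @ v2 j @ t2 j"
  assumes J: "finite J" "\<And>j. j \<in> J \<Longrightarrow> j + 2 * \<kappa> \<le> n"
    and len: "\<And>j. j \<in> J \<Longrightarrow> length (p1 j) \<le> \<kappa> \<and> length (t1 j) \<le> \<kappa> \<and> length (p2 j) \<le> \<kappa>"
      "\<And>j. j \<in> J \<Longrightarrow> length (v1 j) = j \<and> length (q j) = m \<and> length (v2 j) = n - j"
    and q: "\<And>j i. j \<in> J \<Longrightarrow> j \<le> i + m + 3 * \<kappa> \<Longrightarrow> i + m \<le> j + 2 * \<kappa> \<Longrightarrow> q j \<noteq> map x [i..<i + m]"
    and err: "\<And>j. j \<in> J \<Longrightarrow> card {i. i < n - j \<and> v2 j ! i \<noteq> x (j + i)} \<le> d"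
    and j: "j \<in> J"
  shows "card {i\<in>J. j \<le> i \<and> W i = W j} \<le> (m + 3 * \<kappa>) + d * (m + 2 * \<kappa> + 1)"
proof -
  let ?Er = "{i. i < n - j \<and> v2 j ! i \<noteq> x (j + i)}"
  \<comment> \<open>In \<open>W j\<close> the tail word \<open>v2 j\<close> starts at position
    \<open>j + D\<close>, and \<open>D\<close> lies between \<open>m\<close> and
    \<open>m + 3 * \<kappa>\<close>.\<close>
  define D where "D = length (p1 j) + length (t1 j) + m + length (p2 j)"
  have W2: "W j ! (j + D + e) = v2 j ! e" if "e < n - j" for e
    using len(2)[OF j] that by (simp add: W_def D_def nth_append)
  have sub: "{i\<in>J. j \<le> i \<and> W i = W j} \<subseteq> {j..<j + (m + 3 * \<kappa>)} \<union> (\<Union>e\<in>?Er. {e + D + j - (m + 2 * \<kappa>)..e + D + j})"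
  proof
    fix i assume "i \<in> {i\<in>J. j \<le> i \<and> W i = W j}"
    then have i: "i \<in> J" "j \<le> i" "W i = W j" by auto
    show "i \<in> {j..<j + (m + 3 * \<kappa>)} \<union> (\<Union>e\<in>?Er. {e + D + j - (m + 2 * \<kappa>)..e + D + j})"
    proof (cases "i < j + (m + 3 * \<kappa>)")
      \<comment> \<open>From this distance on, the insertion \<open>q i\<close> starts no earlier
        than \<open>v2 j\<close> does; the nearer cuts are simply counted.\<close>
      case False
      define d' where "d' = length (p1 i) + length (t1 i)"
      have d': "d' \<le> 2 * \<kappa>" using len(1)[OF i(1)] by (simp add: d'_def)
      have D: "m \<le> D" "D \<le> m + 3 * \<kappa>" using len(1)[OF j] by (auto simp: D_def)
      have Wq: "W i ! (i + d' + k) = q i ! k" if "k < m" for k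
        using len(2)[OF i(1)] that by (simp add: W_def d'_def nth_append)
      \<comment> \<open>The common word shows \<open>q i\<close> from position \<open>i + d'\<close>
        on, where the tail word of cut \<open>j\<close> is meant to copy \<open>x\<close> from
        \<open>a\<close> on. As \<open>a + m\<close> lies between \<open>i - 3 * \<kappa>\<close>
        and \<open>i + 2 * \<kappa>\<close>, the hypothesis on \<open>q\<close> applies, and the
        margin \<open>2 * \<kappa>\<close> in the hypothesis on \<open>J\<close> keeps the stretch
        inside the tail.\<close>
      define a where "a = i + d' - D"
      have a: "j \<le> a" "a + D = i + d'" using False D by (auto simp: a_def)
      have n: "a + m \<le> n" using a d' D J(2)[OF i(1)] by linarith
      have "\<exists>k<m. a - j + k \<in> ?Er"
      proof (rule ccontr)
        assume no: "\<not> ?thesis"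
        have "q i ! k = x (a + k)" if k: "k < m" for k
        proof -
          have lt: "a - j + k < n - j" using n a k by linarith
          then have "v2 j ! (a - j + k) = x (j + (a - j + k))" using no k by blast
          also have "j + (a - j + k) = a + k" using a by simp
          finally have "v2 j ! (a - j + k) = x (a + k)" .
          moreover have "W j ! (j + D + (a - j + k)) = v2 j ! (a - j + k)" by (rule W2[OF lt])
          moreover have "j + D + (a - j + k) = i + d' + k" using a by linarith
          ultimately show ?thesis using Wq[OF k] i(3) by simp
        qed
        then have "q i = map x [a..<a + m]" using len(2)[OF i(1)] by (intro nth_equalityI) auto
        moreover have "i \<le> a + m + 3 * \<kappa>" "a + m \<le> i + 2 * \<kappa>" using a d' D by linarith+
        ultimately show False using q[OF i(1)] by blast
      qed
      then obtain k where k: "k < m" "a - j + k \<in> ?Er" by auto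
      \<comment> \<open>With \<open>e = a - j + k\<close>, solving for \<open>i\<close> gives
        \<open>i = e + D + j - d' - k\<close>, where \<open>d' + k \<le> m + 2 * \<kappa>\<close>:
        each error accounts for at most \<open>m + 2 * \<kappa> + 1\<close> cuts.\<close>
      have "i \<in> {(a - j + k) + D + j - (m + 2 * \<kappa>)..(a - j + k) + D + j}" using a k(1) d' by simp
      with k show ?thesis by blast
    qed (use i in auto)
  qed
  have "card {i\<in>J. j \<le> i \<and> W i = W j} \<le> card ({j..<j + (m + 3 * \<kappa>)} \<union> (\<Union>e\<in>?Er. {e + D + j - (m + 2 * \<kappa>)..e + D + j}))"
    by (rule card_mono[OF _ sub]) auto
  also have "\<dots> \<le> card {j..<j + (m + 3 * \<kappa>)} + card (\<Union>e\<in>?Er. {e + D + j - (m + 2 * \<kappa>)..e + D + j})"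
    by (rule card_Un_le)
  also have "card (\<Union>e\<in>?Er. {e + D + j - (m + 2 * \<kappa>)..e + D + j}) \<le> (\<Sum>e\<in>?Er. card {e + D + j - (m + 2 * \<kappa>)..e + D + j})"
    by (rule card_UN_le) simp
  also have "\<dots> \<le> (\<Sum>e\<in>?Er. m + 2 * \<kappa> + 1)" by (intro sum_mono) auto
  also have "\<dots> = card ?Er * (m + 2 * \<kappa> + 1)" by simp
  also have "\<dots> \<le> d * (m + 2 * \<kappa> + 1)" using err[OF j] by (intro mult_right_mono) auto
  finally show ?thesis by simp
qed

text \<open>At most \<open>5 * \<kappa> + 1\<close> starting positions fall into the window,
  whatever \<open>m\<close> is. This matters because \<kappa> is fixed before \<open>Q\<close>,
  while \<open>m\<close> results from the choice of \<open>Q\<close>.\<close>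

lemma exists_avoiding_insertion:
  assumes "finite Q" "5 * \<kappa> + 1 < card Q"
  shows "\<exists>q\<in>Q. \<forall>i. j \<le> i + m + 3 * \<kappa> \<longrightarrow> i + m \<le> j + 2 * \<kappa> \<longrightarrow> q \<noteq> map x [i..<i + m]"
proof -
  let ?I = "{i. j \<le> i + m + 3 * \<kappa> \<and> i + m \<le> j + 2 * \<kappa>}"
  have "card ?I \<le> card {j - 3 * \<kappa>..j + 2 * \<kappa>}"
    by (rule card_inj_on_le[of "\<lambda>i. i + m"]) (auto simp: inj_on_def)
  also have "\<dots> \<le> 5 * \<kappa> + 1" by simp
  finally have I: "card ?I \<le> 5 * \<kappa> + 1" .
  have fin: "finite ?I" by (rule finite_subset[of _ "{..j + 2 * \<kappa>}"]) auto
  have "card ((\<lambda>i. map x [i..<i + m]) ` ?I) < card Q"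
    using card_image_le[OF fin, of "\<lambda>i. map x [i..<i + m]"] I assms(2) by linarith
  then have "\<not> Q \<subseteq> (\<lambda>i. map x [i..<i + m]) ` ?I"
    using card_mono[OF finite_imageI[OF fin], of Q "\<lambda>i. map x [i..<i + m]"] by linarith
  then show ?thesis by blast
qed

text \<open>On the parts \<open>v\<close> and \<open>v'\<close> the orbit of \<open>y\<close>
  shadows two stretches of the orbit of \<open>x\<close>, and the comparison of Birkhoff sums
  applies to each. The letters of \<open>p\<close>, \<open>u\<close> and \<open>t\<close>,
  \<open>length W - n\<close> in number, are charged the full bound \<open>b\<close>.\<close>

lemma birkhoff_sum_word_ge:
  fixes \<phi> :: "(nat \<Rightarrow> 'a) \<Rightarrow> real" and b :: real
  assumes X: "shift_space A X" "x \<in> X" "y \<in> X"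
    and C: "0 \<le> C" "0 < \<theta>" "\<theta> < 1"
    and h: "\<And>x y k. x \<in> X \<Longrightarrow> y \<in> X \<Longrightarrow> (\<forall>i<k. x i = y i) \<Longrightarrow> \<bar>\<phi> x - \<phi> y\<bar> \<le> C * \<theta> ^ k"
    and b: "\<And>x. x \<in> X \<Longrightarrow> \<bar>\<phi> x\<bar> \<le> b"
    and y: "\<And>i. i < length W \<Longrightarrow> y i = W ! i" and W: "W = p @ v @ u @ v' @ t"
    and v: "length v = j" "length v' = n - j" "j \<le> n"
    and d: "card {i. i < j \<and> v ! i \<noteq> x i} \<le> d" "card {i. i < n - j \<and> v' ! i \<noteq> x (j + i)} \<le> d"
  shows "(\<Sum>k<n. \<phi> ((shift ^^ k) x)) - 2 * ((real d + 1) * (C / (1 - \<theta>))) - real (length W - n) * b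
    \<le> (\<Sum>k<length W. \<phi> ((shift ^^ k) y))"
proof -
  define f where "f = (\<lambda>k. \<phi> ((shift ^^ k) y))"
  have mem: "(shift ^^ k) z \<in> X" if "z \<in> X" for k z using funpow_shift_mem[OF X(1) that] .
  have lb: "- (real N * b) \<le> (\<Sum>i<N. f (a + i))" for N a
  proof -
    have "(\<Sum>i<N. - b) \<le> (\<Sum>i<N. f (a + i))"
      using b[OF mem[OF X(3)]] by (intro sum_mono) (auto simp: f_def abs_le_iff minus_le_iff)
    then show ?thesis by simp
  qed
  define s where "s = length p + j + length u"
  have l: "length W = length p + (j + (length u + ((n - j) + length t)))" using v by (simp add: W)
  have "y (i + length p) = v ! i" if "i < j" for i
    using y[of "i + length p"] that v by (simp add: W nth_append)
  then have "{i. i < j \<and> (shift ^^ length p) y i \<noteq> x i} = {i. i < j \<and> v ! i \<noteq> x i}"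
    by (auto simp: funpow_shift)
  then have 1: "\<bar>(\<Sum>i<j. \<phi> ((shift ^^ i) ((shift ^^ length p) y))) - (\<Sum>i<j. \<phi> ((shift ^^ i) x))\<bar> \<le> (real d + 1) * (C / (1 - \<theta>))"
    using d by (intro birkhoff_sum_diff_le[OF X(1) mem[OF X(3)] X(2) C h]) auto
  have "y (i + s) = v' ! i" if "i < n - j" for i
    using y[of "i + s"] that v by (simp add: W nth_append s_def)
  then have "{i. i < n - j \<and> (shift ^^ s) y i \<noteq> (shift ^^ j) x i} = {i. i < n - j \<and> v' ! i \<noteq> x (j + i)}"
    by (auto simp: funpow_shift add.commute)
  then have 2: "\<bar>(\<Sum>i<n - j. \<phi> ((shift ^^ i) ((shift ^^ s) y))) - (\<Sum>i<n - j. \<phi> ((shift ^^ i) ((shift ^^ j) x)))\<bar> \<le> (real d + 1) * (C / (1 - \<theta>))"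
    using d by (intro birkhoff_sum_diff_le[OF X(1) mem[OF X(3)] mem[OF X(2)] C h]) auto
  have comp: "(shift ^^ i) ((shift ^^ a) z) = (shift ^^ (a + i)) z" for i a and z :: "nat \<Rightarrow> 'a"
    by (simp add: funpow_shift add_ac)
  have "(\<Sum>k<length W. f k) = (\<Sum>i<length p. f i) + ((\<Sum>i<j. f (length p + i)) + ((\<Sum>i<length u. f (length p + j + i))
     + ((\<Sum>i<n - j. f (s + i)) + (\<Sum>i<length t. f (s + (n - j) + i)))))"
    unfolding l by (simp only: sum_lessThan_add s_def add.assoc)
  moreover have "(\<Sum>k<n. \<phi> ((shift ^^ k) x)) = (\<Sum>k<j. \<phi> ((shift ^^ k) x)) + (\<Sum>k<n - j. \<phi> ((shift ^^ (j + k)) x))"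
    using v(3) sum_lessThan_add[of "\<lambda>k. \<phi> ((shift ^^ k) x)" j "n - j"] by simp
  moreover have "real (length W - n) * b = real (length p) * b + real (length u) * b + real (length t) * b"
    using v(3) unfolding l by (simp add: algebra_simps)
  ultimately show ?thesis
    using 1 2 lb[of "length p" 0] lb[of "length u" "length p + j"] lb[of "length t" "s + (n - j)"]
    unfolding comp f_def abs_le_iff add_0 by linarith
qed

text \<open>The words of the block code: cut \<open>x\<close> at a position \<open>j\<close>, approximate both parts by words of
  \<open>G\<close>, and insert a word of \<open>Q\<close> that does not occur in \<open>x\<close> near the cut.\<close>

lemma many_words_with_large_sums:
  fixes \<phi> :: "(nat \<Rightarrow> 'a) \<Rightarrow> real" and b :: real and g :: "nat \<Rightarrow> nat"
  assumes X: "shift_space A X" "x \<in> X"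
    and C: "0 \<le> C" "0 < \<theta>" "\<theta> < 1"
    and h: "\<And>x y k. x \<in> X \<Longrightarrow> y \<in> X \<Longrightarrow> (\<forall>i<k. x i = y i) \<Longrightarrow> \<bar>\<phi> x - \<phi> y\<bar> \<le> C * \<theta> ^ k"
    and b: "\<And>x. x \<in> X \<Longrightarrow> \<bar>\<phi> x\<bar> \<le> b"
    and g: "mono_on {1..} g" "n\<^sub>0 \<ge> 1"
    and approx: "\<And>n w. n \<ge> n\<^sub>0 \<Longrightarrow> w \<in> words_of_length (language X) n \<Longrightarrow>
      \<exists>v\<in>words_of_length G n. hamming_dist v w \<le> g n"
    and F: "\<And>a b. a \<in> F \<Longrightarrow> b \<in> F \<Longrightarrow> a @ b \<in> F"
      "\<And>v. v \<in> G \<Longrightarrow> \<exists>p t. length p \<le> \<kappa> \<and> length t \<le> \<kappa> \<and> p @ v @ t \<in> F"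
    and Q: "Q \<subseteq> F" "finite Q" "\<And>q. q \<in> Q \<Longrightarrow> length q = m" "5 * \<kappa> + 1 < card Q"
  shows "\<exists>E l. E \<subseteq> F \<and> finite E \<and> (\<forall>e\<in>E. length e = l) \<and> n \<le> l \<and> l \<le> n + m + 4 * \<kappa> \<and>
    n - 2 * n\<^sub>0 - 2 * \<kappa> \<le> ((m + 3 * \<kappa>) + g n * (m + 2 * \<kappa> + 1)) * (4 * \<kappa> + 1) * card E \<and>
    (\<forall>e\<in>E. \<forall>y\<in>X. (\<forall>i<l. y i = e ! i) \<longrightarrow>
      (\<Sum>k<n. \<phi> ((shift ^^ k) x)) - 2 * ((real (g n) + 1) * (C / (1 - \<theta>))) - real (m + 4 * \<kappa>) * b
        \<le> (\<Sum>k<l. \<phi> ((shift ^^ k) y)))"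
proof -
  \<comment> \<open>Both parts have length at least \<open>n\<^sub>0\<close>, as approximation
    requires; the margin \<open>2 * \<kappa>\<close> keeps a displaced insertion inside the
    tail.\<close>
  define J where "J = {n\<^sub>0..<n - n\<^sub>0 - 2 * \<kappa>}"
  have J: "n\<^sub>0 \<le> j \<and> n\<^sub>0 \<le> n - j \<and> j + 2 * \<kappa> \<le> n" if "j \<in> J" for j using that by (auto simp: J_def)
  have near: "\<exists>v\<in>G. length v = N \<and> card {k. k < N \<and> v ! k \<noteq> x (i + k)} \<le> g n" if N: "n\<^sub>0 \<le> N" "N \<le> n" for i N
  proof -
    have "map x [i..<i + N] \<in> words_of_length (language X) N"
      using X(2) by (auto simp: words_of_length_def language_def)
    then obtain v where v: "v \<in> words_of_length G N" "hamming_dist v (map x [i..<i + N]) \<le> g N"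
      using approx[OF N(1)] by blast
    have "{k. k < N \<and> v ! k \<noteq> x (i + k)} = {k. k < length v \<and> v ! k \<noteq> map x [i..<i + N] ! k}"
      using v by (auto simp: words_of_length_def)
    \<comment> \<open>Monotonicity replaces the error bounds for the parts, which depend on the cut,
      by a single one.\<close>
    moreover have "g N \<le> g n" using N g by (intro mono_onD[OF g(1)]) auto
    ultimately show ?thesis using v by (intro bexI[of _ v]) (auto simp: words_of_length_def hamming_dist_def)
  qed
  have "\<exists>v\<in>G. length v = j \<and> card {k. k < j \<and> v ! k \<noteq> x k} \<le> g n" if "j \<in> J" for j
    using near[of j 0] J[OF that] by simp
  then obtain v1 where v1: "\<And>j. j \<in> J \<Longrightarrow> v1 j \<in> G \<and> length (v1 j) = j \<and> card {k. k < j \<and> v1 j ! k \<noteq> x k} \<le> g n"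
    by metis
  have "\<exists>v\<in>G. length v = n - j \<and> card {k. k < n - j \<and> v ! k \<noteq> x (j + k)} \<le> g n" if "j \<in> J" for j
    using near[of "n - j" j] J[OF that] by simp
  then obtain v2 where v2: "\<And>j. j \<in> J \<Longrightarrow> v2 j \<in> G \<and> length (v2 j) = n - j \<and> card {k. k < n - j \<and> v2 j ! k \<noteq> x (j + k)} \<le> g n"
    by metis
  obtain p t where pt: "\<And>v. v \<in> G \<Longrightarrow> length (p v) \<le> \<kappa> \<and> length (t v) \<le> \<kappa> \<and> p v @ v @ t v \<in> F"
    using F(2) by metis
  have "\<exists>q\<in>Q. \<forall>i. j \<le> i + m + 3 * \<kappa> \<longrightarrow> i + m \<le> j + 2 * \<kappa> \<longrightarrow> q \<noteq> map x [i..<i + m]" for j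
    by (rule exists_avoiding_insertion[OF Q(2,4)])
  then obtain q where q: "\<And>j. q j \<in> Q"
    "\<And>j i. j \<le> i + m + 3 * \<kappa> \<Longrightarrow> i + m \<le> j + 2 * \<kappa> \<Longrightarrow> q j \<noteq> map x [i..<i + m]"
    by metis
  define W where "W = (\<lambda>j. p (v1 j) @ v1 j @ t (v1 j) @ q j @ p (v2 j) @ v2 j @ t (v2 j))"
  have WF: "W j \<in> F" if "j \<in> J" for j
  proof -
    have "p (v1 j) @ v1 j @ t (v1 j) \<in> F" "p (v2 j) @ v2 j @ t (v2 j) \<in> F" "q j \<in> F"
      using pt v1[OF that] v2[OF that] q(1) Q(1) by blast+
    then have "(p (v1 j) @ v1 j @ t (v1 j)) @ q j @ (p (v2 j) @ v2 j @ t (v2 j)) \<in> F"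
      using F(1) by blast
    then show ?thesis by (simp add: W_def)
  qed
  have Wl: "length (W j) \<in> {n + m..n + m + 4 * \<kappa>}" if "j \<in> J" for j
    using pt[of "v1 j"] pt[of "v2 j"] v1[OF that] v2[OF that] Q(3)[OF q(1), of j] J[OF that] by (simp add: W_def)
  have "card J \<le> ((m + 3 * \<kappa>) + g n * (m + 2 * \<kappa> + 1)) * card (W ` J)"
    unfolding W_def
  proof (rule card_image_ge)
    fix j assume "j \<in> J"
    then show "card {i\<in>J. j \<le> i \<and> p (v1 i) @ v1 i @ t (v1 i) @ q i @ p (v2 i) @ v2 i @ t (v2 i)
        = p (v1 j) @ v1 j @ t (v1 j) @ q j @ p (v2 j) @ v2 j @ t (v2 j)} \<le> (m + 3 * \<kappa>) + g n * (m + 2 * \<kappa> + 1)"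
      using pt v1 v2 q Q(3) J by (intro card_same_word_le[where x = x]) (auto simp: J_def)
  qed (simp add: J_def)
  \<comment> \<open>A block code needs words of one length; four extensions of length at most
    \<kappa> leave \<open>4 * \<kappa> + 1\<close> possibilities.\<close>
  moreover have "\<exists>l\<in>{n + m..n + m + 4 * \<kappa>}. card (W ` J) \<le> card {n + m..n + m + 4 * \<kappa>} * card {e\<in>W ` J. length e = l}"
    using Wl by (intro pigeonhole_fibre) auto
  then obtain l where l: "n + m \<le> l" "l \<le> n + m + 4 * \<kappa>" "card (W ` J) \<le> (4 * \<kappa> + 1) * card {e\<in>W ` J. length e = l}"
    by auto
  ultimately have "card J \<le> ((m + 3 * \<kappa>) + g n * (m + 2 * \<kappa> + 1)) * ((4 * \<kappa> + 1) * card {e\<in>W ` J. length e = l})"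
    by (meson order_trans mult_le_mono2)
  moreover have "card J = n - 2 * n\<^sub>0 - 2 * \<kappa>" by (simp add: J_def)
  ultimately have card: "n - 2 * n\<^sub>0 - 2 * \<kappa> \<le> ((m + 3 * \<kappa>) + g n * (m + 2 * \<kappa> + 1)) * (4 * \<kappa> + 1) * card {e\<in>W ` J. length e = l}"
    by (simp only: mult.assoc)
  have sums: "(\<Sum>k<n. \<phi> ((shift ^^ k) x)) - 2 * ((real (g n) + 1) * (C / (1 - \<theta>))) - real (m + 4 * \<kappa>) * b
        \<le> (\<Sum>k<l. \<phi> ((shift ^^ k) y))"
    if j: "j \<in> J" "length (W j) = l" and y: "y \<in> X" "\<forall>i<l. y i = W j ! i" for y j
  proof -
    have "(\<Sum>k<n. \<phi> ((shift ^^ k) x)) - 2 * ((real (g n) + 1) * (C / (1 - \<theta>))) - real (length (W j) - n) * b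
        \<le> (\<Sum>k<length (W j). \<phi> ((shift ^^ k) y))"
      using y j v1[OF j(1)] v2[OF j(1)] J[OF j(1)]
      by (intro birkhoff_sum_word_ge[OF X y(1) C h b, where v = "v1 j" and v' = "v2 j" and p = "p (v1 j)"
          and t = "t (v2 j)" and u = "t (v1 j) @ q j @ p (v2 j)" and j = j]) (auto simp: W_def)
    moreover have "0 \<le> b" using b[OF X(2)] by linarith
    then have "real (length (W j) - n) * b \<le> real (m + 4 * \<kappa>) * b" using j l by (intro mult_right_mono) auto
    ultimately show ?thesis unfolding j(2)[symmetric] by linarith
  qed
  show ?thesis
    using card sums WF l by (intro exI[of _ "{e\<in>W ` J. length e = l}"] exI[of _ l]) (auto simp: J_def)
qed

text \<open>Finite concatenations lie in \<open>F\<close>, hence in the language, so every prefix of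
  the infinite one is a prefix of a point of \<open>X\<close>; closedness does the rest.\<close>

lemma concat_blocks_mem:
  assumes X: "shift_space A X" and F: "F \<subseteq> language X" "\<And>a b. a \<in> F \<Longrightarrow> b \<in> F \<Longrightarrow> a @ b \<in> F"
    and E: "E \<subseteq> F" "\<And>e. e \<in> E \<Longrightarrow> length e = l" "0 < l" and \<omega>: "\<And>i. \<omega> i \<in> E"
  shows "concat_blocks l \<omega> \<in> X"
proof (rule prefix_limit_mem[OF X])
  \<comment> \<open>The induction starts with one block, since \<open>F\<close> may lack the empty
    word.\<close>
  have block: "concat (map \<omega> [0..<Suc N]) \<in> F \<and> length (concat (map \<omega> [0..<Suc N])) = Suc N * l \<and>
     (\<forall>i<Suc N * l. concat (map \<omega> [0..<Suc N]) ! i = concat_blocks l \<omega> i)" for N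
  proof (induction N)
    case 0
    then show ?case using \<omega>[of 0] E by (auto simp: concat_blocks_def)
  next
    case (Suc N)
    let ?c = "concat (map \<omega> [0..<Suc N])"
    have c: "concat (map \<omega> [0..<Suc (Suc N)]) = ?c @ \<omega> (Suc N)" by simp
    have len: "length ?c = Suc N * l" "length (\<omega> (Suc N)) = l" using Suc E \<omega> by auto
    have "(?c @ \<omega> (Suc N)) ! i = concat_blocks l \<omega> i" if i: "i < Suc (Suc N) * l" for i
    proof (cases "i < Suc N * l")
      case True
      then show ?thesis using Suc len by (simp add: nth_append del: upt_Suc)
    next
      case False
      define k where "k = i - Suc N * l"
      have k: "i = k + Suc N * l" "k < l" using False i by (auto simp: k_def)
      have "i div l = Suc N" "i mod l = k" using k by (auto simp: div_mult_self1 simp del: mult_Suc)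
      then show ?thesis using False len k by (simp add: nth_append concat_blocks_def del: upt_Suc mult_Suc)
    qed
    moreover have "?c @ \<omega> (Suc N) \<in> F" using Suc \<omega> E(1) by (intro F(2)) auto
    ultimately show ?case unfolding c using len by (simp del: upt_Suc)
  qed
  show "\<exists>y\<in>X. \<forall>i<n. y i = concat_blocks l \<omega> i" for n
  proof -
    have "concat (map \<omega> [0..<Suc n]) \<in> language X" using block F(1) by blast
    then obtain y N where y: "y \<in> X" "concat (map \<omega> [0..<Suc n]) = map y [0..<N]"
      by (auto simp: language_eq[OF X])
    have N: "N = Suc n * l" using arg_cong[OF y(2), of length] block[of n] by (simp del: upt_Suc)
    have "n \<le> Suc n * l" using E(3) by (cases l) auto
    then have "y i = concat_blocks l \<omega> i" if "i < n" for i
      using block[of n] y(2) N that by (auto simp del: upt_Suc)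
    then show ?thesis using y(1) by blast
  qed
  show "concat_blocks l \<omega> \<in> full_shift A"
  proof -
    have "\<omega> (i div l) ! (i mod l) \<in> set (\<omega> (i div l))" for i using E \<omega> by (intro nth_mem) simp
    moreover have "\<omega> (i div l) \<in> lists A" for i using \<omega> E F(1) language_lists[OF X] by blast
    ultimately show ?thesis by (auto simp: full_shift_def concat_blocks_def)
  qed
qed

section \<open>Hyperbolicity\<close>

text \<open>Here \<open>e\<close> stands for the number of words of the block code. The hypothesis
  on \<open>e\<close> makes \<open>ln e\<close> at least roughly \<open>ln n - ln (ln n)\<close>,
  while \<open>K * g n\<close> is eventually below any fixed fraction of \<open>ln n\<close>. The
  fraction 1/4 is an arbitrary choice, and \<open>K + 1\<close> in the proof guards against dividing
  by \<open>K = 0\<close>.\<close>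

lemma eventually_entropy_gain:
  fixes g :: "nat \<Rightarrow> nat" and a b c d K :: real
  assumes g: "(\<lambda>n. real (g n) / ln (real n)) \<longlonglongrightarrow> 0" and pos: "0 \<le> K" "0 < b" "0 < c"
  shows "\<forall>\<^sub>F n in sequentially. \<forall>e\<ge>0. real n - a \<le> (b + c * g n) * e \<longrightarrow> d + K * g n < ln e"
proof -
  have "\<forall>\<^sub>F n in sequentially. d + 1/4 * ln (real n) < ln ((real n - a) / (b + c * ln (real n)))"
    using pos by real_asymp
  moreover have "\<forall>\<^sub>F n in sequentially. real n > a" by real_asymp
  moreover have "\<forall>\<^sub>F n in sequentially. real (g n) \<le> 1 / (4 * (K + 1)) * ln (real n)"
    using pos by (intro eventually_le_mult_ln[OF g]) simp
  moreover have "\<forall>\<^sub>F n in sequentially. real (g n) \<le> 1 * ln (real n)"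
    by (intro eventually_le_mult_ln[OF g]) simp
  ultimately show ?thesis
  proof (eventually_elim, intro allI impI)
    fix n e assume n: "d + 1/4 * ln (real n) < ln ((real n - a) / (b + c * ln (real n)))" "real n > a"
      "real (g n) \<le> 1 / (4 * (K + 1)) * ln (real n)" "real (g n) \<le> 1 * ln (real n)"
      and e: "0 \<le> e" "real n - a \<le> (b + c * g n) * e"
    have ln: "0 \<le> ln (real n)" using n(4) by linarith
    have den: "0 < b + c * ln (real n)" using pos ln by (simp add: add_pos_nonneg)
    have "real n - a \<le> (b + c * ln (real n)) * e"
      using e(2) by (rule order_trans) (use e(1) n(4) pos in \<open>auto intro!: mult_right_mono\<close>)
    then have "(real n - a) / (b + c * ln (real n)) \<le> e" using den by (simp add: field_simps)
    moreover have "0 < (real n - a) / (b + c * ln (real n))" using den n(2) by simp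
    ultimately have "ln ((real n - a) / (b + c * ln (real n))) \<le> ln e" by (intro ln_mono) auto
    moreover have "K * g n \<le> 1/4 * ln (real n)"
    proof -
      have "K * g n \<le> K * (1 / (4 * (K + 1)) * ln (real n))" using n(3) pos by (intro mult_left_mono)
      also have "\<dots> = K / (K + 1) * (1/4 * ln (real n))" using pos by (simp add: field_simps)
      also have "\<dots> \<le> 1 * (1/4 * ln (real n))" using pos ln by (intro mult_right_mono) auto
      finally show ?thesis by simp
    qed
    ultimately show "d + K * g n < ln e" using n(1) by linarith
  qed
qed

theorem theorem1p1:
  fixes A :: "'a set" and X :: "(nat \<Rightarrow> 'a) set" and g :: "nat \<Rightarrow> nat"
    and G :: "'a list set" and \<phi> :: "(nat \<Rightarrow> 'a) \<Rightarrow> real"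
  assumes "finite A"
    and "shift_space A X"
    and "topological_entropy X > 0"
    and "g \<in> {1..} \<rightarrow> {1..}"
    and "mono_on {1..} g"
    and "(\<lambda>n. real (g n) / ln (real n)) \<longlonglongrightarrow> 0"
    and "G \<subseteq> language X"
    and "has_specification (language X) G"
    and "hamming_approachable g (language X) G"
    and "hoelder_on X \<phi>"
  shows "hyperbolic A X \<phi>"
proof -
  note X = \<open>finite A\<close> \<open>shift_space A X\<close>
  obtain C \<theta> where C: "0 \<le> C" "0 < \<theta>" "\<theta> < 1"
    and h: "\<And>x y k. x \<in> X \<Longrightarrow> y \<in> X \<Longrightarrow> (\<forall>i<k. x i = y i) \<Longrightarrow> \<bar>\<phi> x - \<phi> y\<bar> \<le> C * \<theta> ^ k"
    using hoelder_onD[OF \<open>hoelder_on X \<phi>\<close>] by blast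
  obtain b where b: "0 \<le> b" "\<And>x. x \<in> X \<Longrightarrow> \<bar>\<phi> x\<bar> \<le> b" using hoelder_bounded[OF \<open>hoelder_on X \<phi>\<close>] by blast
  have meas: "\<phi> \<in> borel_measurable (borel_on A X)" by (rule hoelder_measurable[OF X \<open>hoelder_on X \<phi>\<close>])
  obtain F \<kappa> where "F \<subseteq> language X \<and> (\<forall>u\<in>F. \<forall>v\<in>F. u @ v \<in> F) \<and>
      (\<forall>v\<in>G. \<exists>p t. length p \<le> \<kappa> \<and> length t \<le> \<kappa> \<and> p @ v @ t \<in> F)"
    using specification_free_concatenation[OF X assms(7,8)] by (elim exE)
  then have F: "F \<subseteq> language X" "\<And>u v. u \<in> F \<Longrightarrow> v \<in> F \<Longrightarrow> u @ v \<in> F"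
      "\<And>v. v \<in> G \<Longrightarrow> \<exists>p t. length p \<le> \<kappa> \<and> length t \<le> \<kappa> \<and> p @ v @ t \<in> F"
    by simp_all
  have "\<exists>Q m. Q \<subseteq> F \<and> finite Q \<and> (\<forall>q\<in>Q. length q = m) \<and> 5 * \<kappa> + 1 < card Q"
    by (rule many_free_words[OF X(1) language_lists[OF X(2)] assms(7) card_words_unbounded[OF X assms(3,7,6,9)] F(3)])
  then obtain Q m where "Q \<subseteq> F \<and> finite Q \<and> (\<forall>q\<in>Q. length q = m) \<and> 5 * \<kappa> + 1 < card Q"
    by (elim exE)
  then have Q: "Q \<subseteq> F" "finite Q" "\<And>q. q \<in> Q \<Longrightarrow> length q = m" "5 * \<kappa> + 1 < card Q"
    by simp_all
  obtain n\<^sub>0 where n0: "n\<^sub>0 \<ge> 1" "\<And>n w. n \<ge> n\<^sub>0 \<Longrightarrow> w \<in> words_of_length (language X) n \<Longrightarrow>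
      \<exists>v\<in>words_of_length G n. hamming_dist v w \<le> g n"
    using assms(9) unfolding hamming_approachable_def by blast
  define R where "R = C / (1 - \<theta>)"
  have R: "0 \<le> R" using C by (simp add: R_def)
  define M where "M = real (m + 4 * \<kappa>)"
  \<comment> \<open>The losses to beat: 1 for taking \<open>x\<^sub>0\<close> only near the
    supremum, \<open>2 * R * (g n + 1)\<close> for the two approximated parts, \<open>M * b\<close>
    for the letters outside them, and \<open>M * (b + 1)\<close> for the passage from length
    \<open>n\<close> to length \<open>l\<close>. The summand 1 in the first coefficient makes it
    visibly positive.\<close>
  have "\<forall>\<^sub>F n in sequentially. \<forall>e\<ge>0. real n - real (2 * n\<^sub>0 + 2 * \<kappa>) \<le>
      (real ((m + 3 * \<kappa>) * (4 * \<kappa> + 1) + 1) + real ((m + 2 * \<kappa> + 1) * (4 * \<kappa> + 1)) * g n) * e \<longrightarrow>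
      (1 + 2 * R + M * b + M * (b + 1)) + 2 * R * g n < ln e"
  proof (rule eventually_entropy_gain[OF assms(6)])
    show "0 < real ((m + 3 * \<kappa>) * (4 * \<kappa> + 1) + 1)" "0 < real ((m + 2 * \<kappa> + 1) * (4 * \<kappa> + 1))"
      unfolding of_nat_0_less_iff by simp_all
  qed (use R in simp)
  \<comment> \<open>This makes the truncated difference in the bound on \<open>card E\<close> exact
    and positive, so that \<open>E\<close> is nonempty.\<close>
  with eventually_gt_at_top[of "2 * n\<^sub>0 + 2 * \<kappa>"]
  have "\<forall>\<^sub>F n in sequentially. 2 * n\<^sub>0 + 2 * \<kappa> < n \<and> (\<forall>e\<ge>0. real n - real (2 * n\<^sub>0 + 2 * \<kappa>) \<le>
      (real ((m + 3 * \<kappa>) * (4 * \<kappa> + 1) + 1) + real ((m + 2 * \<kappa> + 1) * (4 * \<kappa> + 1)) * g n) * e \<longrightarrow>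
      (1 + 2 * R + M * b + M * (b + 1)) + 2 * R * g n < ln e)"
    by (rule eventually_conj)
  then obtain n where n: "2 * n\<^sub>0 + 2 * \<kappa> < n" and gain: "\<And>e. 0 \<le> e \<Longrightarrow> real n - real (2 * n\<^sub>0 + 2 * \<kappa>) \<le>
      (real ((m + 3 * \<kappa>) * (4 * \<kappa> + 1) + 1) + real ((m + 2 * \<kappa> + 1) * (4 * \<kappa> + 1)) * g n) * e \<Longrightarrow>
      (1 + 2 * R + M * b + M * (b + 1)) + 2 * R * g n < ln e"
    unfolding eventually_sequentially by blast
  have "Q \<noteq> {}" using Q(4) by auto
  then have "X \<noteq> {}" using Q(1) F(1) by (auto simp: language_def)
  define S where "S = (\<lambda>x. \<Sum>k<n. \<phi> ((shift ^^ k) x))"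
  have Sb: "S x \<le> n * b" if "x \<in> X" for x
  proof -
    have "S x \<le> (\<Sum>k<n. b)" unfolding S_def
      using b(2) funpow_shift_mem[OF X(2) that] by (intro sum_mono) (auto simp: abs_le_iff)
    then show ?thesis by simp
  qed
  then have bdd: "bdd_above (S ` X)" by (auto simp: bdd_above_def)
  have "(SUP x\<in>X. S x) - 1 < (SUP x\<in>X. S x)" by simp
  then obtain x\<^sub>0 where x0: "x\<^sub>0 \<in> X" "(SUP x\<in>X. S x) - 1 < S x\<^sub>0"
    using less_cSUP_iff[OF \<open>X \<noteq> {}\<close> bdd] by blast
  have Sx0: "S x \<le> S x\<^sub>0 + 1" if "x \<in> X" for x
    using cSUP_upper[OF that bdd] x0(2) by linarith
  define \<sigma> where "\<sigma> = (S x\<^sub>0 + 1) / n"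
  have npos: "1 \<le> real n" using n by simp
  have sup: "(SUP \<mu> \<in> invariant_measures A X. ereal (integral\<^sup>L \<mu> \<phi>)) \<le> ereal \<sigma>"
  proof (rule SUP_least)
    fix \<mu> assume "\<mu> \<in> invariant_measures A X"
    then have "n * integral\<^sup>L \<mu> \<phi> \<le> S x\<^sub>0 + 1"
      using Sx0 unfolding S_def by (intro invariant_integral_le[OF X _ meas b(2)])
    then show "ereal (integral\<^sup>L \<mu> \<phi>) \<le> ereal \<sigma>" using npos by (simp add: \<sigma>_def field_simps)
  qed
  have "\<exists>E l. E \<subseteq> F \<and> finite E \<and> (\<forall>e\<in>E. length e = l) \<and> n \<le> l \<and> l \<le> n + m + 4 * \<kappa> \<and>
    n - 2 * n\<^sub>0 - 2 * \<kappa> \<le> ((m + 3 * \<kappa>) + g n * (m + 2 * \<kappa> + 1)) * (4 * \<kappa> + 1) * card E \<and>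
    (\<forall>e\<in>E. \<forall>y\<in>X. (\<forall>i<l. y i = e ! i) \<longrightarrow>
      S x\<^sub>0 - 2 * ((real (g n) + 1) * R) - M * b \<le> (\<Sum>k<l. \<phi> ((shift ^^ k) y)))"
    unfolding S_def R_def M_def by (rule many_words_with_large_sums[OF X(2) x0(1) C h b(2) assms(5) n0 F(2,3) Q])
  then obtain E l where "E \<subseteq> F \<and> finite E \<and> (\<forall>e\<in>E. length e = l) \<and> n \<le> l \<and> l \<le> n + m + 4 * \<kappa> \<and>
    n - 2 * n\<^sub>0 - 2 * \<kappa> \<le> ((m + 3 * \<kappa>) + g n * (m + 2 * \<kappa> + 1)) * (4 * \<kappa> + 1) * card E \<and>
    (\<forall>e\<in>E. \<forall>y\<in>X. (\<forall>i<l. y i = e ! i) \<longrightarrow>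
      S x\<^sub>0 - 2 * ((real (g n) + 1) * R) - M * b \<le> (\<Sum>k<l. \<phi> ((shift ^^ k) y)))"
    by (elim exE)
  then have E: "E \<subseteq> F" "finite E" "\<And>e. e \<in> E \<Longrightarrow> length e = l" and l: "n \<le> l" "l \<le> n + m + 4 * \<kappa>"
    and cardE: "n - 2 * n\<^sub>0 - 2 * \<kappa> \<le> ((m + 3 * \<kappa>) + g n * (m + 2 * \<kappa> + 1)) * (4 * \<kappa> + 1) * card E"
    and sums: "\<And>e y. e \<in> E \<Longrightarrow> y \<in> X \<Longrightarrow> (\<forall>i<l. y i = e ! i) \<Longrightarrow>
      S x\<^sub>0 - 2 * ((real (g n) + 1) * R) - M * b \<le> (\<Sum>k<l. \<phi> ((shift ^^ k) y))"
    by simp_all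
  have "real (n - 2 * n\<^sub>0 - 2 * \<kappa>) \<le> real (((m + 3 * \<kappa>) + g n * (m + 2 * \<kappa> + 1)) * (4 * \<kappa> + 1) * card E)"
    using cardE by (rule of_nat_mono)
  also have "\<dots> \<le> (real ((m + 3 * \<kappa>) * (4 * \<kappa> + 1) + 1) + real ((m + 2 * \<kappa> + 1) * (4 * \<kappa> + 1)) * g n) * card E"
    by (simp add: algebra_simps)
  finally have lnE: "(1 + 2 * R + M * b + M * (b + 1)) + 2 * R * g n < ln (card E)"
    using n by (intro gain) auto
  have "E \<noteq> {}" using cardE n by auto
  have "0 < l" using l n by simp
  have EX: "concat_blocks l \<omega> \<in> X" if "\<And>i. \<omega> i \<in> E" for \<omega>
    by (rule concat_blocks_mem[OF X(2) F(1,2) E(1,3) \<open>0 < l\<close> that])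
  have "S x\<^sub>0 - 2 * ((real (g n) + 1) * R) - M * b \<le> (\<Sum>k<l. \<phi> ((shift ^^ k) (concat_blocks l \<omega>)))"
    if "\<And>i. \<omega> i \<in> E" for \<omega>
    by (rule sums[OF that[of 0] EX[OF that]]) (simp add: concat_blocks_def)
  then obtain \<nu> where \<nu>: "\<nu> \<in> invariant_measures A X" "ereal (ln (card E) / l) \<le> measure_entropy \<nu> shift"
    "(S x\<^sub>0 - 2 * ((real (g n) + 1) * R) - M * b) / l \<le> integral\<^sup>L \<nu> \<phi>"
    using block_code_measure[OF X E(2) \<open>E \<noteq> {}\<close> \<open>0 < l\<close> E(3) EX meas b(2)] by blast
  have "\<sigma> < ln (card E) / l + (S x\<^sub>0 - 2 * ((real (g n) + 1) * R) - M * b) / l"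
  proof -
    \<comment> \<open>The resulting bound on \<sigma> limits what the \<open>l - n\<close>
      additional letters cost when sums are divided by \<open>l\<close> instead of
      \<open>n\<close>.\<close>
    have "S x\<^sub>0 + 1 \<le> n * (b + 1)" using Sb[OF x0(1)] npos by (simp add: algebra_simps)
    then have "\<sigma> \<le> b + 1" using npos by (simp add: \<sigma>_def field_simps)
    then have "real (l - n) * \<sigma> \<le> real (l - n) * (b + 1)" by (intro mult_left_mono) auto
    also have "\<dots> \<le> M * (b + 1)" using l b(1) by (intro mult_right_mono) (auto simp: M_def)
    finally have "real l * \<sigma> \<le> real n * \<sigma> + M * (b + 1)" using l by (simp add: algebra_simps of_nat_diff)
    moreover have "real n * \<sigma> = S x\<^sub>0 + 1" using npos by (simp add: \<sigma>_def)
    ultimately have "real l * \<sigma> < ln (card E) + (S x\<^sub>0 - 2 * ((real (g n) + 1) * R) - M * b)"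
      using lnE by (simp add: algebra_simps)
    then show ?thesis using \<open>0 < l\<close> by (simp add: field_simps)
  qed
  then have "ereal \<sigma> < ereal (ln (card E) / l) + ereal ((S x\<^sub>0 - 2 * ((real (g n) + 1) * R) - M * b) / l)" by simp
  also have "\<dots> \<le> measure_entropy \<nu> shift + ereal (integral\<^sup>L \<nu> \<phi>)"
    using \<nu>(2,3) by (intro add_mono) auto
  also have "\<dots> \<le> pressure A X \<phi>" unfolding pressure_def using \<nu>(1) by (rule SUP_upper)
  finally show ?thesis using sup by (simp add: hyperbolic_def)
qed

end
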